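(* There is a constant $C$ such that for every $M\in\mathbb{N}$ there is a $1$-thick topological embedding of $K_M$ (the complete graph on $M$ vertices) into $\mathbb{H}^3_{\mathbb{R}}$ with diameter $\leq C\ln(1+M)$ and volume $\leq CM^2$, and a $1$-thick topological embedding of $K_M$ into $\mathbb{H}^2_{\mathbb{R}}\times\mathbb{R}$ with diameter $\leq CM$ and volume $\leq CM^2$.
   Context: $\mathbb{H}^q_{\mathbb{R}}$ is real hyperbolic space of dimension $q$; products carry the product Riemannian metric and Riemannian volume. A graph is identified with its topological realisation (one unit interval for each edge, with endpoints labelled by the same vertex identified). For a metric space $Z$ and $\varepsilon>0$, a topological embedding $g:\Gamma\to Z$ of a graph $\Gamma$ is $\varepsilon$-thick if $d_Z(g(x),g(y))\geq\varepsilon$ whenever $x,y$ are: two distinct vertices; an edge and a vertex not contained in that edge; or two disjoint edges (the distance being the distance between the image sets). The diameter of $g$ is the diameter of its image. The volume of $g$ is the measure of the $1$-neighbourhood of its image. *)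

theory Defs
  imports "HOL-Analysis.Analysis"
begin

section \<open>Real hyperbolic space\<close>

text \<open>
  The upper half-space model: horizontal coordinates in a Euclidean space \<open>'a\<close> and a positive
  height, with Riemannian metric \<open>(|dx|^2 + dt^2) / t^2\<close>. Its dimension is one more than that
  of \<open>'a\<close>. The distance function and the volume form of this Riemannian metric are taken as
  definitions.
\<close>

typedef (overloaded) 'a hyperbolic = "{p :: 'a::euclidean_space \<times> real. 0 < snd p}"
  morphisms coords of_coords
  by (rule exI[of _ "(0, 1)"]) simp

type_synonym hyp2 = "real hyperbolic"
type_synonym hyp3 = "(real ^ 2) hyperbolic"

definition height :: "'a::euclidean_space hyperbolic \<Rightarrow> real" where
  "height p = snd (coords p)"

lemma snd_coords_pos [simp]: "0 < snd (coords p)"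
  using coords[of p] by simp

lemma height_pos [simp]: "0 < height p"
  by (simp add: height_def)

lemma norm_inversion:
  fixes a b :: "'a::real_inner"
  assumes "a \<noteq> 0" "b \<noteq> 0"
  shows "norm (a /\<^sub>R (norm a)\<^sup>2 - b /\<^sub>R (norm b)\<^sup>2) = norm (a - b) / (norm a * norm b)"
proof (rule power2_eq_imp_eq)
  have A: "(a \<bullet> a) = (norm a)\<^sup>2" "(b \<bullet> b) = (norm b)\<^sup>2" "norm a \<noteq> 0" "norm b \<noteq> 0"
    using assms by (auto simp: power2_norm_eq_inner)
  show "(norm (a /\<^sub>R (norm a)\<^sup>2 - b /\<^sub>R (norm b)\<^sup>2))\<^sup>2 = (norm (a - b) / (norm a * norm b))\<^sup>2"
    unfolding power_divide power2_norm_eq_inner[of "_ - _"]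
    using A by (simp add: inner_diff_left inner_diff_right inner_commute[of b a] field_simps power2_eq_square)
qed simp_all

lemma ptolemy_norm:
  fixes a b c :: "'a::real_inner"
  shows "norm (a - b) * norm c \<le> norm (a - c) * norm b + norm (b - c) * norm a"
proof -
  consider "a = 0" | "b = 0" | "c = 0" | "a \<noteq> 0" "b \<noteq> 0" "c \<noteq> 0" by blast
  then show ?thesis
  proof cases
    case 4
    have "norm (a - b) / (norm a * norm b)
        \<le> norm (a - c) / (norm a * norm c) + norm (c - b) / (norm c * norm b)"
      unfolding norm_inversion[OF 4(1,2), symmetric] norm_inversion[OF 4(1,3), symmetric]
        norm_inversion[OF 4(3,2), symmetric]
      unfolding dist_norm[symmetric] by (rule dist_triangle)
    then show ?thesis
      using 4 by (simp add: field_simps norm_minus_commute[of c b])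
  qed (auto simp: norm_minus_commute)
qed

lemma ptolemy:
  fixes x y z w :: "'a::real_inner"
  shows "dist x y * dist z w \<le> dist x z * dist y w + dist y z * dist x w"
  using ptolemy_norm[of "x - w" "y - w" "z - w"] by (simp add: dist_norm)

instantiation hyperbolic :: (euclidean_space) metric_space
begin

definition dist_hyperbolic :: "'a hyperbolic \<Rightarrow> 'a hyperbolic \<Rightarrow> real" where
  "dist p q = arcosh (1 + (dist (coords p) (coords q))\<^sup>2 / (2 * height p * height q))"

definition uniformity_hyperbolic :: "('a hyperbolic \<times> 'a hyperbolic) filter" where
  "uniformity_hyperbolic = (INF e\<in>{0 <..}. principal {(x, y). dist x y < e})"

definition open_hyperbolic :: "'a hyperbolic set \<Rightarrow> bool" where
  "open_hyperbolic U \<longleftrightarrow> (\<forall>x\<in>U. eventually (\<lambda>(x', y). x' = x \<longrightarrow> y \<in> U) uniformity)"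

lemma dist_hyperbolic_arsinh:
  fixes p q :: "'a hyperbolic"
  shows "dist p q = 2 * arsinh (dist (coords p) (coords q) / (2 * sqrt (height p * height q)))"
proof -
  define y where "y = dist (coords p) (coords q) / (2 * sqrt (height p * height q))"
  have y: "0 \<le> y" by (simp add: y_def less_imp_le)
  have "1 + (dist (coords p) (coords q))\<^sup>2 / (2 * height p * height q) = 1 + 2 * y\<^sup>2"
    by (simp add: y_def power_divide power_mult_distrib less_imp_le field_simps)
  also have "\<dots> = cosh (2 * arsinh y)"
    by (simp add: cosh_double cosh_square_eq)
  finally show ?thesis
    using y arsinh_real_neg_iff[of y]
    by (simp add: dist_hyperbolic_def arcosh_cosh_real not_less[symmetric] flip: y_def)
qed

instance
proof
  show "uniformity = (INF e\<in>{0 <..}. principal {(x :: 'a hyperbolic, y). dist x y < e})"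
    by (rule uniformity_hyperbolic_def)
  show "open U \<longleftrightarrow> (\<forall>x\<in>U. eventually (\<lambda>(x', y). x' = x \<longrightarrow> y \<in> U) uniformity)"
    for U :: "'a hyperbolic set"
    by (rule open_hyperbolic_def)
  show "dist p q = 0 \<longleftrightarrow> p = q" for p q :: "'a hyperbolic"
    using height_pos[of p] height_pos[of q]
    by (auto simp: dist_hyperbolic_arsinh coords_inject simp del: height_pos)
  show "dist p q \<le> dist p r + dist q r" for p q r :: "'a hyperbolic"
  proof -
    define bar where "bar = (\<lambda>z :: 'a \<times> real. (fst z, - snd z))"
    define S where "S = (\<lambda>p q :: 'a hyperbolic. dist (coords p) (coords q) / (2 * sqrt (height p * height q)))"
    define K where "K = (\<lambda>p q :: 'a hyperbolic. dist (coords p) (bar (coords q)) / (2 * sqrt (height p * height q)))"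
    have K: "cosh (arsinh (S p q)) = K p q" for p q
    proof (rule power2_eq_imp_eq)
      have eq: "(dist (coords p) (bar (coords q)))\<^sup>2 = (dist (coords p) (coords q))\<^sup>2 + 4 * (height p * height q)"
        by (simp add: dist_prod_def bar_def height_def dist_real_def) (simp add: power2_eq_square algebra_simps)
      show "(cosh (arsinh (S p q)))\<^sup>2 = (K p q)\<^sup>2"
        using height_pos[of p, THEN less_imp_neq] height_pos[of q, THEN less_imp_neq]
        by (simp add: cosh_square_eq S_def K_def power_divide power_mult_distrib less_imp_le eq
          add_divide_distrib)
    qed (simp_all add: K_def less_imp_le)
    have rr: "dist (coords r) (bar (coords r)) = 2 * height r"
      by (simp add: dist_prod_def bar_def height_def[symmetric] dist_real_def real_sqrt_mult less_imp_le)
    have *: "dist (coords p) (coords q) * (2 * height r)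
        \<le> dist (coords p) (coords r) * dist (coords q) (bar (coords r))
          + dist (coords q) (coords r) * dist (coords p) (bar (coords r))"
      using ptolemy[of "coords p" "coords q" "coords r" "bar (coords r)"] by (simp add: rr)
    have "S p q \<le> S p r * K q r + K p r * S q r"
    proof -
      have sq: "sqrt (height p * height r) * sqrt (height q * height r) = sqrt (height p * height q) * height r"
        by (simp add: real_sqrt_mult less_imp_le)
      have comb: "a / (2 * s) * (b / (2 * t)) + c / (2 * s) * (d / (2 * t)) = (a * b + d * c) / (4 * (s * t))"
        for a b c d s t :: real
        by (simp add: add_divide_distrib mult.commute mult.left_commute)
      have "S p q = dist (coords p) (coords q) * (2 * height r) / (4 * (sqrt (height p * height q) * height r))"
        using height_pos[of r, THEN less_imp_neq] by (simp add: S_def)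
      also have "\<dots> \<le> (dist (coords p) (coords r) * dist (coords q) (bar (coords r))
          + dist (coords q) (coords r) * dist (coords p) (bar (coords r)))
          / (4 * (sqrt (height p * height q) * height r))"
        using * by (intro divide_right_mono) (simp_all add: less_imp_le)
      also have "\<dots> = S p r * K q r + K p r * S q r"
        unfolding S_def K_def comb sq ..
      finally show ?thesis .
    qed
    also have "\<dots> = sinh (arsinh (S p r) + arsinh (S q r))"
      by (simp add: sinh_add K)
    finally have "arsinh (S p q) \<le> arsinh (S p r) + arsinh (S q r)"
      by (metis arsinh_less_iff_real arsinh_sinh_real not_less)
    then show ?thesis
      by (simp add: dist_hyperbolic_arsinh S_def)
  qed
qed

end


lemma coords_of_coords: "0 < snd z \<Longrightarrow> coords (of_coords z) = z"
  by (simp add: of_coords_inverse)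

lemma continuous_on_of_coords:
  "continuous_on {z. 0 < snd z} (of_coords :: 'a::euclidean_space \<times> real \<Rightarrow> 'a hyperbolic)"
  unfolding continuous_on
proof
  fix z :: "'a \<times> real" assume z: "z \<in> {z. 0 < snd z}"
  have "continuous_on {z. 0 < snd z} (\<lambda>w :: 'a \<times> real. arcosh (1 + (dist w z)\<^sup>2 / (2 * snd w * snd z)))"
    by (rule continuous_on_compose2[OF continuous_on_arcosh[OF order.refl]]) (use z in \<open>auto intro!: continuous_intros simp: less_imp_le\<close>)
  then have "((\<lambda>w. arcosh (1 + (dist w z)\<^sup>2 / (2 * snd w * snd z))) \<longlongrightarrow> arcosh (1 + (dist z z)\<^sup>2 / (2 * snd z * snd z)))
      (at z within {z. 0 < snd z})"
    using z unfolding continuous_on by blast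
  then have "((\<lambda>w. arcosh (1 + (dist w z)\<^sup>2 / (2 * snd w * snd z))) \<longlongrightarrow> 0) (at z within {z. 0 < snd z})"
    by simp
  then have "((\<lambda>w. dist (of_coords w) (of_coords z)) \<longlongrightarrow> 0) (at z within {z. 0 < snd z})"
    by (rule Lim_transform_eventually)
      (use z in \<open>auto simp: eventually_at_filter dist_hyperbolic_def height_def coords_of_coords\<close>)
  then show "(of_coords \<longlongrightarrow> of_coords z) (at z within {z. 0 < snd z})"
    by (subst tendsto_dist_iff)
qed

lemma cosh_dist_hyperbolic:
  "cosh (dist p q) = 1 + (dist (coords p) (coords q))\<^sup>2 / (2 * height p * height q)"
  unfolding dist_hyperbolic_def by (rule cosh_arcosh_real) (simp add: less_imp_le)

lemma continuous_on_coords: "continuous_on A (coords :: 'a::euclidean_space hyperbolic \<Rightarrow> _)"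
proof (rule continuous_on_subset)
  show "continuous_on UNIV (coords :: 'a hyperbolic \<Rightarrow> _)"
    unfolding continuous_on
  proof
    fix p :: "'a hyperbolic"
    have bound: "dist (coords q) (coords p)
      \<le> sqrt (4 * (height p)\<^sup>2 * cosh (dist q p) * (cosh (dist q p) - 1))" for q
    proof (rule real_le_rsqrt)
      define c where "c = cosh (dist q p)"
      define D where "D = dist (coords q) (coords p)"
      have c: "1 \<le> c" by (simp add: c_def cosh_real_ge_1)
      have D: "D\<^sup>2 = 2 * height p * height q * (c - 1)"
        using height_pos[of p] height_pos[of q]
        by (simp add: c_def D_def cosh_dist_hyperbolic field_simps del: height_pos)
      have "\<bar>height q - height p\<bar> \<le> D"
        using dist_snd_le[of "coords q" "coords p"] by (simp add: D_def height_def dist_real_def)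
      then have "\<bar>height q - height p\<bar>\<^sup>2 \<le> D\<^sup>2"
        by (rule power_mono) simp
      then have "height q * height q \<le> height q * (2 * height p * c) - (height p)\<^sup>2"
        unfolding power2_abs D by (simp add: power2_eq_square algebra_simps)
      also have "\<dots> \<le> height q * (2 * height p * c)" by simp
      finally have "height q \<le> 2 * height p * c" by simp
      then have "2 * height p * (c - 1) * height q \<le> 2 * height p * (c - 1) * (2 * height p * c)"
        using c by (intro mult_left_mono) (auto simp: less_imp_le)
      then show "(dist (coords q) (coords p))\<^sup>2 \<le> 4 * (height p)\<^sup>2 * cosh (dist q p) * (cosh (dist q p) - 1)"
        unfolding D_def[symmetric] c_def[symmetric] D by (simp add: power2_eq_square algebra_simps)
    qed
    have "((\<lambda>q. sqrt (4 * (height p)\<^sup>2 * cosh (dist q p) * (cosh (dist q p) - 1)))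
        \<longlongrightarrow> sqrt (4 * (height p)\<^sup>2 * cosh (dist p p) * (cosh (dist p p) - 1))) (at p)"
      by (intro tendsto_intros)
    then have "((\<lambda>q. dist (coords q) (coords p)) \<longlongrightarrow> 0) (at p)"
      by (intro tendsto_sandwich[OF _ _ tendsto_const, where g = "\<lambda>q. dist (coords q) (coords p)"])
        (auto intro!: always_eventually bound)
    then show "(coords \<longlongrightarrow> coords p) (at p)"
      by (subst tendsto_dist_iff)
  qed
qed simp

instance hyperbolic :: (euclidean_space) second_countable_topology
proof
  obtain B :: "('a \<times> real) set set" where B: "countable B" "topological_basis B"
    using ex_countable_basis by blast
  have "topological_basis ((\<lambda>b. coords -` b) ` B :: 'a hyperbolic set set)"
    unfolding topological_basis_def
  proof (intro conjI ballI allI impI)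
    fix U :: "'a hyperbolic set" assume "U \<in> (\<lambda>b. coords -` b) ` B"
    then show "open U"
      using B(2) continuous_on_coords[of UNIV] by (auto intro!: open_vimage dest: topological_basis_open)
  next
    fix U :: "'a hyperbolic set" assume U: "open U"
    have "open {z :: 'a \<times> real. 0 < snd z}"
      by (intro open_Collect_less continuous_intros)
    then have "open (of_coords -` U \<inter> {z. 0 < snd z})"
      using continuous_open_preimage[OF continuous_on_of_coords _ U] by (simp add: Int_commute)
    then obtain B' where B': "B' \<subseteq> B" "\<Union>B' = of_coords -` U \<inter> {z. 0 < snd z}"
      using B(2) unfolding topological_basis_def by meson
    have "\<Union>((\<lambda>b. coords -` b) ` B') = coords -` (\<Union>B')" by auto
    also have "\<dots> = U"
      unfolding B'(2) by (intro set_eqI) (simp add: coords_inverse)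
    finally show "\<exists>B'\<subseteq>(\<lambda>b. coords -` b) ` B. \<Union>B' = U"
      using B'(1) by blast
  qed
  then show "\<exists>B :: 'a hyperbolic set set. countable B \<and> open = generate_topology B"
    using B(1) topological_basis_imp_subbasis by blast
qed

text \<open>The Riemannian volume: \<open>dx dt / t^q\<close> in dimension \<open>q = DIM('a) + 1\<close>.\<close>

definition hyperbolic_volume :: "'a::euclidean_space hyperbolic measure" where
  "hyperbolic_volume =
     distr (density (restrict_space lborel {z :: 'a \<times> real. 0 < snd z})
             (\<lambda>z. ennreal (1 / snd z ^ (DIM('a) + 1))))
       borel of_coords"

lemma measurable_of_coords:
  "(of_coords :: 'a::euclidean_space \<times> real \<Rightarrow> 'a hyperbolic)
     \<in> borel_measurable (restrict_space borel {z. 0 < snd z})"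
  by (rule borel_measurable_continuous_on_restrict[OF continuous_on_of_coords])

lemma measurable_coords: "(coords :: 'a::euclidean_space hyperbolic \<Rightarrow> _) \<in> borel_measurable borel"
  by (rule borel_measurable_continuous_onI[OF continuous_on_coords])

lemma sets_hyperbolic_volume: "sets hyperbolic_volume = sets borel"
  by (simp add: hyperbolic_volume_def)

lemma emeasure_hyperbolic_volume:
  fixes A :: "'a::euclidean_space hyperbolic set"
  assumes A: "A \<in> sets borel"
  shows "emeasure hyperbolic_volume A =
    (\<integral>\<^sup>+ z \<in> coords ` A. ennreal (1 / snd z ^ (DIM('a) + 1)) \<partial>lborel)"
proof -
  let ?H = "{z :: 'a \<times> real. 0 < snd z}"
  have H: "?H \<in> sets borel"
    by (intro borel_open open_Collect_less continuous_intros)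
  have im: "coords ` A = of_coords -` A \<inter> ?H"
  proof
    show "coords ` A \<subseteq> of_coords -` A \<inter> ?H"
      by (auto simp: coords_inverse simp del: split_paired_All)
    show "of_coords -` A \<inter> ?H \<subseteq> coords ` A"
    proof
      fix z assume "z \<in> of_coords -` A \<inter> ?H"
      then show "z \<in> coords ` A"
        by (intro image_eqI[of _ _ "of_coords z"]) (simp_all add: coords_of_coords)
    qed
  qed
  have of: "of_coords \<in> restrict_space lborel ?H \<rightarrow>\<^sub>M (borel :: 'a hyperbolic measure)"
    using measurable_of_coords by (simp add: measurable_def sets_restrict_space space_restrict_space)
  have im_sets: "coords ` A \<in> sets (restrict_space lborel ?H)"
    using measurable_sets[OF of A] by (simp add: im space_restrict_space)
  have dens: "(\<lambda>z :: 'a \<times> real. ennreal (1 / snd z ^ (DIM('a) + 1))) \<in> borel_measurable (restrict_space lborel ?H)"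
  proof (rule measurable_restrict_space1)
    have [measurable]: "(snd :: 'a \<times> real \<Rightarrow> real) \<in> borel_measurable borel"
      by (intro borel_measurable_continuous_onI continuous_intros)
    show "(\<lambda>z :: 'a \<times> real. ennreal (1 / snd z ^ (DIM('a) + 1))) \<in> borel_measurable lborel"
      unfolding measurable_lborel2 by measurable
  qed
  have "emeasure hyperbolic_volume A =
      emeasure (density (restrict_space lborel ?H) (\<lambda>z. ennreal (1 / snd z ^ (DIM('a) + 1)))) (coords ` A)"
    unfolding hyperbolic_volume_def
    by (subst emeasure_distr) (use of A in \<open>auto simp: im space_restrict_space\<close>)
  also have "\<dots> = (\<integral>\<^sup>+ z. ennreal (1 / snd z ^ (DIM('a) + 1)) * indicator (coords ` A) z \<partial>restrict_space lborel ?H)"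
    by (rule emeasure_density[OF dens im_sets])
  also have "\<dots> = (\<integral>\<^sup>+ z. ennreal (1 / snd z ^ (DIM('a) + 1)) * indicator (coords ` A) z * indicator ?H z \<partial>lborel)"
    using H by (subst nn_integral_restrict_space) auto
  also have "\<dots> = (\<integral>\<^sup>+ z \<in> coords ` A. ennreal (1 / snd z ^ (DIM('a) + 1)) \<partial>lborel)"
    by (rule nn_integral_cong) (auto simp: im split: split_indicator)
  finally show ?thesis .
qed

text \<open>
  The distance of a product Riemannian metric is the library's (Pythagorean) distance on the
  product type, and its volume is the product measure. The next lemma makes open sets measurable.
\<close>

lemma sets_hyperbolic_volume_pair:
  "sets (hyperbolic_volume \<Otimes>\<^sub>M lborel :: ('a::euclidean_space hyperbolic \<times> real) measure) = sets borel"
proof -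
  have "sets (hyperbolic_volume \<Otimes>\<^sub>M lborel :: ('a hyperbolic \<times> real) measure)
      = sets (borel \<Otimes>\<^sub>M (borel :: real measure))"
    by (intro sets_pair_measure_cong) (simp_all add: sets_hyperbolic_volume)
  then show ?thesis by (simp only: borel_prod)
qed


section \<open>Graphs and their realisations\<close>

text \<open>For simple graphs: an edge is the set of its two endpoints.\<close>

record 'v graph =
  verts :: "'v set"
  edges :: "'v set set"

definition complete_graph :: "nat \<Rightarrow> nat graph" where
  "complete_graph M = \<lparr>verts = {..<M}, edges = {e. e \<subseteq> {..<M} \<and> card e = 2}\<rparr>"

text \<open>
  A point of the realisation is a vertex or lies in the interior of an edge. The linear order
  on the vertices serves only to choose a direction for the unit interval of each edge: the
  parameter 0 is labelled by the smaller endpoint and 1 by the larger.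
\<close>

datatype 'v point = Vertex 'v | Inner "'v set" real

definition edge_point :: "'v::linorder set \<Rightarrow> real \<Rightarrow> 'v point" where
  "edge_point e t = (if t = 0 then Vertex (Min e) else if t = 1 then Vertex (Max e) else Inner e t)"

definition closed_edge :: "'v::linorder set \<Rightarrow> 'v point set" where
  "closed_edge e = edge_point e ` {0..1}"

definition points :: "'v::linorder graph \<Rightarrow> 'v point set" where
  "points G = Vertex ` verts G \<union> (\<Union>e\<in>edges G. closed_edge e)"

text \<open>The quotient topology of the disjoint union of the vertices and the unit intervals.\<close>

definition realisation :: "'v::linorder graph \<Rightarrow> 'v point topology" where
  "realisation G = topology (\<lambda>U. U \<subseteq> points G \<and>
     (\<forall>e\<in>edges G. openin (top_of_set {0..1}) {t \<in> {0..1}. edge_point e t \<in> U}))"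

lemma openin_realisation:
  "openin (realisation G) U \<longleftrightarrow> U \<subseteq> points G \<and>
     (\<forall>e\<in>edges G. openin (top_of_set {0..1}) {t \<in> {0..1}. edge_point e t \<in> U})"
proof -
  have "istopology (\<lambda>U. U \<subseteq> points G \<and>
     (\<forall>e\<in>edges G. openin (top_of_set {0..1}) {t \<in> {0..1}. edge_point e t \<in> U}))"
    unfolding istopology_def
  proof (intro conjI allI impI ballI)
    fix S T e
    assume "S \<subseteq> points G \<and> (\<forall>e\<in>edges G. openin (top_of_set {0..1}) {t \<in> {0..1}. edge_point e t \<in> S})"
      and "T \<subseteq> points G \<and> (\<forall>e\<in>edges G. openin (top_of_set {0..1}) {t \<in> {0..1}. edge_point e t \<in> T})"
      and "e \<in> edges G"
    then have "openin (top_of_set {0..1})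
        ({t \<in> {0..1}. edge_point e t \<in> S} \<inter> {t \<in> {0..1}. edge_point e t \<in> T})"
      by (intro openin_Int) auto
    also have "{t \<in> {0..1}. edge_point e t \<in> S} \<inter> {t \<in> {0..1}. edge_point e t \<in> T}
        = {t \<in> {0..1}. edge_point e t \<in> S \<inter> T}" by auto
    finally show "openin (top_of_set {0..1}) {t \<in> {0..1}. edge_point e t \<in> S \<inter> T}" .
  next
    fix \<K> e
    assume "\<forall>K\<in>\<K>. K \<subseteq> points G \<and> (\<forall>e\<in>edges G. openin (top_of_set {0..1}) {t \<in> {0..1}. edge_point e t \<in> K})"
      and "e \<in> edges G"
    then have "openin (top_of_set {0..1}) (\<Union>K\<in>\<K>. {t \<in> {0..1}. edge_point e t \<in> K})"
      by (intro openin_Union) auto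
    also have "(\<Union>K\<in>\<K>. {t \<in> {0..1}. edge_point e t \<in> K}) = {t \<in> {0..1}. edge_point e t \<in> \<Union>\<K>}" by auto
    finally show "openin (top_of_set {0..1}) {t \<in> {0..1}. edge_point e t \<in> \<Union>\<K>}" .
  qed auto
  then show ?thesis
    by (simp add: realisation_def topology_inverse')
qed

lemma topspace_realisation: "topspace (realisation G) = points G"
proof -
  have "{t \<in> {0..1}. edge_point e t \<in> points G} = {0..1}" if "e \<in> edges G" for e
    using that by (auto simp: points_def closed_edge_def)
  then have "openin (realisation G) (points G)"
    by (simp add: openin_realisation)
  then show ?thesis
    by (meson openin_realisation openin_subset openin_topspace subset_antisym)
qed


section \<open>Thick embeddings\<close>

definition thick_embedding ::
    "real \<Rightarrow> 'v::linorder graph \<Rightarrow> ('v point \<Rightarrow> 'z::metric_space) \<Rightarrow> bool" where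
  "thick_embedding \<epsilon> G g \<longleftrightarrow>
     embedding_map (realisation G) euclidean g \<and>
     (\<forall>v\<in>verts G. \<forall>w\<in>verts G. v \<noteq> w \<longrightarrow> \<epsilon> \<le> dist (g (Vertex v)) (g (Vertex w))) \<and>
     (\<forall>e\<in>edges G. \<forall>v\<in>verts G. v \<notin> e \<longrightarrow> \<epsilon> \<le> setdist (g ` closed_edge e) {g (Vertex v)}) \<and>
     (\<forall>e\<in>edges G. \<forall>f\<in>edges G. e \<inter> f = {} \<longrightarrow> \<epsilon> \<le> setdist (g ` closed_edge e) (g ` closed_edge f))"

definition image_diameter :: "'v::linorder graph \<Rightarrow> ('v point \<Rightarrow> 'z::metric_space) \<Rightarrow> real" where
  "image_diameter G g = diameter (g ` points G)"

definition neighbourhood :: "real \<Rightarrow> 'z::metric_space set \<Rightarrow> 'z set" where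
  "neighbourhood r A = (\<Union>a\<in>A. ball a r)"

definition image_volume ::
    "'z::metric_space measure \<Rightarrow> 'v::linorder graph \<Rightarrow> ('v point \<Rightarrow> 'z) \<Rightarrow> ennreal" where
  "image_volume \<mu> G g = emeasure \<mu> (neighbourhood 1 (g ` points G))"

end

theory Submission
  imports Defs
begin

text \<open>
  Both embeddings come from one layout of \<open>K\<^sub>M\<close> in the flat box \<open>[0, M] \<times> [0, M] \<times> [0, 1]\<close>. Vertex \<open>v\<close>
  sits at \<open>(v, v, 0)\<close>, and the edge \<open>i < j\<close> follows the row \<open>y = i\<close> in the bottom layer and then the
  column \<open>x = j\<close> in the top layer, so that disjoint edges use different rows and columns and cross
  only in different layers. Edges with a common endpoint would overlap; they are pulled apart by
  small perturbations, which need no lower bound because thickness says nothing about such pairs.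
  In the upper half-space, the box becomes a neighbourhood of bounded height over a square of a
  horosphere, whose volume is quadratic and whose diameter is logarithmic in the side length. In
  \<open>H\<^sup>2 \<times> \<real>\<close> it becomes the product of such a neighbourhood over a horocyclic segment and an interval.
\<close>

section \<open>The layout in a flat box\<close>

text \<open>With clamped parameters each coordinate of \<open>route\<close> is a single formula, so
  its continuity needs no gluing of pieces.\<close>

definition clamp01 :: "real \<Rightarrow> real" where
  "clamp01 t = max 0 (min 1 t)"

lemma continuous_on_clamp01 [continuous_intros]:
  "continuous_on A f \<Longrightarrow> continuous_on A (\<lambda>x. clamp01 (f x))"
  unfolding clamp01_def by (intro continuous_intros)

text \<open>An injective sequence in the interval from 0 to 1/4: columns leading into the same
  vertex become distinct but stay within a quarter of it.\<close>

definition shift :: "nat \<Rightarrow> real" where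
  "shift i = 1 / (real i + 4)"

lemma shift_bounds: "0 < shift i" "shift i \<le> 1/4"
  by (simp_all add: shift_def field_simps)

lemma shift_eq_iff: "shift i = shift k \<longleftrightarrow> i = k"
  by (simp add: shift_def field_simps)

text \<open>
  Four linear pieces, for \<open>t\<close> in \<open>[0, 4]\<close>: along the row, up, along the column, down to the vertex.
  Edges leaving \<open>i\<close> form a fan of distinct slopes in the row; edges arriving at \<open>j\<close> run in the column
  at the distinct offsets \<open>shift i\<close>.
\<close>

definition route :: "nat \<Rightarrow> nat \<Rightarrow> real \<Rightarrow> real \<times> real \<times> real" where
  "route i j t =
    (real i + (real j - shift i - real i) * clamp01 t + shift i * clamp01 (t - 3),
     real i + clamp01 t / 4 + (real j - real i - 1/4) * clamp01 (t - 2),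
     clamp01 (t - 1) - clamp01 (t - 3))"

lemma continuous_on_route: "continuous_on A (route i j)"
  unfolding route_def by (auto intro!: continuous_intros)

lemma route_pieces:
  "0 \<le> t \<Longrightarrow> t \<le> 1 \<Longrightarrow> route i j t = (real i + (real j - shift i - real i) * t, real i + t / 4, 0)"
  "1 \<le> t \<Longrightarrow> t \<le> 2 \<Longrightarrow> route i j t = (real j - shift i, real i + 1/4, t - 1)"
  "2 \<le> t \<Longrightarrow> t \<le> 3 \<Longrightarrow>
    route i j t = (real j - shift i, real i + 1/4 + (real j - real i - 1/4) * (t - 2), 1)"
  "3 \<le> t \<Longrightarrow> t \<le> 4 \<Longrightarrow> route i j t = (real j - shift i * (4 - t), real j, 4 - t)"
  by (simp_all add: route_def clamp01_def algebra_simps)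

lemma route_ends: "route i j 0 = (real i, real i, 0)" "route i j 4 = (real j, real j, 0)"
  by (simp_all add: route_pieces)

text \<open>The break points are given to the two horizontal pieces. Thus \<open>up\<close> has
  height strictly between 0 and 1 and \<open>down\<close> has height below 1, and most pairs of
  pieces differ already in the third coordinate.\<close>

lemma route_cases:
  assumes "0 \<le> t" "t \<le> 4"
  obtains (row) "t \<le> 1" "route i j t = (real i + (real j - shift i - real i) * t, real i + t / 4, 0)"
  | (up) "1 < t" "t < 2" "route i j t = (real j - shift i, real i + 1/4, t - 1)"
  | (column) "2 \<le> t" "t \<le> 3"
      "route i j t = (real j - shift i, real i + 1/4 + (real j - real i - 1/4) * (t - 2), 1)"
  | (down) "3 < t" "route i j t = (real j - shift i * (4 - t), real j, 4 - t)"
proof -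
  consider "t \<le> 1" | "1 < t" "t < 2" | "2 \<le> t" "t \<le> 3" | "3 < t"
    by linarith
  then show thesis
    using assms that by cases (simp_all add: route_pieces)
qed

section \<open>Bounds for the pieces of a route\<close>

lemma real_nat_gap: "i < j \<Longrightarrow> real i + 1 \<le> real j"
  by linarith

lemma row_x_bounds:
  assumes "i < j" "0 \<le> t" "t \<le> 1"
  shows "real i \<le> real i + (real j - shift i - real i) * t"
    "real i + (real j - shift i - real i) * t \<le> real j"
proof -
  have "0 \<le> real j - shift i - real i"
    using real_nat_gap[OF assms(1)] shift_bounds(2)[of i] by linarith
  then have "0 \<le> (real j - shift i - real i) * t" "(real j - shift i - real i) * t \<le> real j - shift i - real i"
    using assms(2,3) by (auto intro: mult_left_le)
  then show "real i \<le> real i + (real j - shift i - real i) * t"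
    "real i + (real j - shift i - real i) * t \<le> real j"
    using shift_bounds(1)[of i] by linarith+
qed

lemma column_y_bounds:
  assumes "i < j" "2 \<le> t" "t \<le> 3"
  shows "real i \<le> real i + 1/4 + (real j - real i - 1/4) * (t - 2)"
    "real i + 1/4 + (real j - real i - 1/4) * (t - 2) \<le> real j"
proof -
  have "0 \<le> real j - real i - 1/4"
    using real_nat_gap[OF assms(1)] by linarith
  then have "0 \<le> (real j - real i - 1/4) * (t - 2)"
     "(real j - real i - 1/4) * (t - 2) \<le> real j - real i - 1/4"
    using assms(2,3) by (auto intro: mult_left_le)
  then show "real i \<le> real i + 1/4 + (real j - real i - 1/4) * (t - 2)"
    "real i + 1/4 + (real j - real i - 1/4) * (t - 2) \<le> real j"
    by linarith+
qed

lemma down_x_bounds: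
  assumes "3 \<le> t" "t \<le> 4"
  shows "real j - 1/4 \<le> real j - shift i * (4 - t)" "real j - shift i * (4 - t) \<le> real j"
proof -
  have "0 \<le> shift i * (4 - t)" "shift i * (4 - t) \<le> shift i"
    using assms shift_bounds(1)[of i] by (auto intro: mult_left_le)
  then show "real j - 1/4 \<le> real j - shift i * (4 - t)" "real j - shift i * (4 - t) \<le> real j"
    using shift_bounds(2)[of i] by linarith+
qed

lemma route_in_box:
  assumes "i < j" "j < M" "0 \<le> t" "t \<le> 4"
  shows "route i j t \<in> {0..real M} \<times> {0..real M} \<times> {0..1}"
  using assms(3,4)
proof (cases rule: route_cases[where i = i and j = j])
  case row
  then show ?thesis
    using row_x_bounds[of i j t] assms real_nat_gap[of i j] by auto
next
  case up
  then show ?thesis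
    using assms shift_bounds[of i] real_nat_gap[of i j] by auto
next
  case column
  then show ?thesis
    using column_y_bounds[of i j t] assms shift_bounds[of i] real_nat_gap[of i j] by auto
next
  case down
  then show ?thesis
    using down_x_bounds[of t j i] assms real_nat_gap[of i j] by auto
qed

text \<open>A coarser case split, made for separation. The last disjunction of \<open>column\<close>
  records how each piece escapes a foreign row: the column by its height, the ascent by staying near
  the row of \<open>i\<close>, the descent by lying at \<open>y = real j\<close>.\<close>

lemma route_row_or_column:
  assumes "i < j" "0 \<le> t" "t \<le> 4"
  obtains (row) x y where "route i j t = (x, y, 0)" "real i \<le> y" "y \<le> real i + 1/4"
  | (column) x y z where "route i j t = (x, y, z)" "real j - 1/4 \<le> x" "x \<le> real j"
      "z = 1 \<or> real i \<le> y \<and> y \<le> real i + 1/4 \<or> y = real j"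
  using assms(2,3)
proof (cases rule: route_cases[where i = i and j = j])
  case row
  show ?thesis by (rule that(1)[OF row(2)]) (use row(1) assms in auto)
next
  case up
  show ?thesis by (rule that(2)[OF up(3)]) (use shift_bounds[of i] in auto)
next
  case column
  show ?thesis by (rule that(2)[OF column(3)]) (use shift_bounds[of i] in auto)
next
  case down
  show ?thesis by (rule that(2)[OF down(2)]) (use down_x_bounds[of t j i] down(1) assms in auto)
qed

section \<open>Separation of vertices and of edges without a common endpoint\<close>

text \<open>The thresholds are chosen so that both target maps turn them into distance at least 1.
  Heights lie between 0 and 1, so a height gap of exactly 1 means that one point is in the bottom
  layer and the other in the top layer.\<close>

definition separated :: "real \<times> real \<times> real \<Rightarrow> real \<times> real \<times> real \<Rightarrow> bool" where
  "separated p q \<longleftrightarrow> 1/2 \<le> \<bar>fst p - fst q\<bar> \<or> 1/2 \<le> \<bar>fst (snd p) - fst (snd q)\<bar> \<or>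
     \<bar>snd (snd p) - snd (snd q)\<bar> = 1"

lemma nat_apart: "i \<noteq> k \<Longrightarrow> real i + 1 \<le> real k \<or> real k + 1 \<le> real i"
  by linarith

lemma separated_by_x:
  assumes "j \<noteq> l" "real j - 1/4 \<le> x" "x \<le> real j" "real l - 1/4 \<le> x'" "x' \<le> real l"
  shows "separated (x, y, z) (x', y', z')"
proof -
  have "1/2 \<le> \<bar>x - x'\<bar>"
    using nat_apart[OF assms(1)] assms(2-) by linarith
  then show ?thesis by (simp add: separated_def)
qed

lemma separated_by_y:
  assumes "i \<noteq> k" "real i \<le> y" "y \<le> real i + 1/4" "real k \<le> y'" "y' \<le> real k + 1/4"
  shows "separated (x, y, z) (x', y', z')"
proof -
  have "1/2 \<le> \<bar>y - y'\<bar>"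
    using nat_apart[OF assms(1)] assms(2-) by linarith
  then show ?thesis by (simp add: separated_def)
qed

lemma separated_commute: "separated p q \<longleftrightarrow> separated q p"
  by (simp add: separated_def abs_minus_commute)

lemma separated_vertices: "v \<noteq> w \<Longrightarrow> separated (real v, real v, z) (real w, real w, z')"
  by (rule separated_by_x) auto

text \<open>The vertex is on the diagonal, so its second coordinate avoids the row of
  \<open>i\<close> and its first coordinate avoids the column of \<open>j\<close>.\<close>

lemma separated_route_vertex:
  assumes "i < j" "0 \<le> t" "t \<le> 4" "v \<noteq> i" "v \<noteq> j"
  shows "separated (route i j t) (real v, real v, 0)"
  using assms(1-3)
proof (cases rule: route_row_or_column)
  case row
  show ?thesis
    unfolding row(1) by (rule separated_by_y[of i v]) (use row assms in auto)
next
  case column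
  show ?thesis
    unfolding column(1) by (rule separated_by_x[of j v]) (use column assms in auto)
qed

text \<open>This is where crossings are resolved: at height 1 the column passes above the row;
  elsewhere its second coordinate is near \<open>k\<close> or equal to \<open>l\<close>, both
  different from \<open>i\<close>.\<close>

lemma separated_row_column:
  assumes "i \<noteq> k" "i \<noteq> l" "real i \<le> y" "y \<le> real i + 1/4"
    and "z = 1 \<or> real k \<le> y' \<and> y' \<le> real k + 1/4 \<or> y' = real l"
  shows "separated (x, y, 0) (x', y', z)"
  using assms(5)
proof (elim disjE)
  assume "z = 1"
  then show ?thesis by (simp add: separated_def)
next
  assume "real k \<le> y' \<and> y' \<le> real k + 1/4"
  then show ?thesis using assms by (intro separated_by_y[of i k]) auto
next
  assume "y' = real l"
  then show ?thesis using assms by (intro separated_by_y[of i l]) auto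
qed

text \<open>Two rows are told apart by their sources, two columns by their targets, and a row and a
  column by \<open>separated_row_column\<close>.\<close>

lemma separated_routes:
  assumes ij: "i < j" "0 \<le> t" "t \<le> 4" and kl: "k < l" "0 \<le> u" "u \<le> 4"
    and ne: "i \<noteq> k" "i \<noteq> l" "j \<noteq> k" "j \<noteq> l"
  shows "separated (route i j t) (route k l u)"
  using ij
proof (cases rule: route_row_or_column)
  case row1: row
  show ?thesis
    using kl
  proof (cases rule: route_row_or_column)
    case row
    show ?thesis
      unfolding row1(1) row(1) by (rule separated_by_y[OF ne(1) row1(2,3) row(2,3)])
  next
    case column
    show ?thesis
      unfolding row1(1) column(1) by (rule separated_row_column[OF ne(1,2) row1(2,3) column(4)])
  qed
next
  case column1: column
  show ?thesis
    using kl
  proof (cases rule: route_row_or_column)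
    case row
    show ?thesis
      unfolding column1(1) row(1)
      by (subst separated_commute,
        rule separated_row_column[OF ne(1)[symmetric] ne(3)[symmetric] row(2,3) column1(4)])
  next
    case column
    show ?thesis
      unfolding column1(1) column(1) by (rule separated_by_x[OF ne(4) column1(2,3) column(2,3)])
  qed
qed

section \<open>Injectivity of the routes away from common endpoints\<close>

lemma route_row_row:
  assumes "i < j" "k < l" "0 \<le> t" "t \<le> 1" "0 \<le> u" "u \<le> 1"
    and x: "real i + (real j - shift i - real i) * t = real k + (real l - shift k - real k) * u"
    and y: "real i + t / 4 = real k + u / 4"
  shows "i = k \<and> t = u \<and> (j = l \<or> t = 0)"
proof -
  \<comment> \<open>The second coordinate rises by at most 1/4 along a row, so it determines first
    the row and then the parameter. The first coordinate then determines \<open>j\<close>, except at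
    the start of the fan.\<close>
  have "i = k"
    using assms(3-6) y nat_apart[of i k] by (cases "i = k") linarith+
  moreover from this have "t = u"
    using y by simp
  ultimately show ?thesis
    using x by auto
qed

text \<open>The offset is positive and at most 1/4, so \<open>real j - shift i\<close> encodes both
  endpoints. Here \<open>t\<close> and \<open>u\<close> are route parameters reduced by 2.\<close>

lemma route_column_column:
  assumes "i < j" and x: "real j - shift i = real l - shift k"
    and y: "real i + 1/4 + (real j - real i - 1/4) * t = real k + 1/4 + (real l - real k - 1/4) * u"
  shows "i = k \<and> j = l \<and> t = u"
proof -
  have "j = l"
    using x nat_apart[of j l] shift_bounds[of i] shift_bounds[of k] by (cases "j = l") linarith+
  moreover from this have "i = k"
    using x by (simp add: shift_eq_iff)
  moreover have "real j - real i - 1/4 \<noteq> 0"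
    using real_nat_gap[OF assms(1)] by linarith
  ultimately show ?thesis
    using y by simp
qed

text \<open>Keeps ascents, which stand a quarter beyond an integer row, away from descents, which
  stand at an integer.\<close>

lemma quarter_neq_nat: "real i + 1/4 \<noteq> real j"
  using nat_apart[of i j] by (cases "i = j") linarith+

lemma row_hits_vertex:
  assumes "real i + t / 4 = real l" "0 \<le> t" "t \<le> 1"
  shows "i = l \<and> t = 0"
proof -
  have "i = l"
    using nat_apart[of i l] assms by (cases "i = l") linarith+
  then show ?thesis using assms(1) by simp
qed

text \<open>The alternatives after the first are the four ways in which two edges share a vertex:
  common source, common target, and the end of one at the start of the other. The proof compares all
  pairs of pieces.\<close>

lemma route_inject:
  assumes ij: "i < j" "0 \<le> t" "t \<le> 4" and kl: "k < l" "0 \<le> u" "u \<le> 4"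
    and eq: "route i j t = route k l u"
  shows "i = k \<and> j = l \<and> t = u \<or> t = 0 \<and> u = 0 \<and> i = k \<or> t = 4 \<and> u = 4 \<and> j = l \<or>
    t = 4 \<and> u = 0 \<and> j = k \<or> t = 0 \<and> u = 4 \<and> i = l"
  using ij(2,3)
proof (cases rule: route_cases[where i = i and j = j])
  case row1: row
  show ?thesis
    using kl(2,3)
  proof (cases rule: route_cases[where i = k and j = l])
    case row
    have "i = k \<and> t = u \<and> (j = l \<or> t = 0)"
      using eq unfolding row1(2) row(2) prod.inject
      by (intro route_row_row[OF ij(1) kl(1) ij(2) row1(1) kl(2) row(1)]) blast+
    then show ?thesis by blast
  next
    case down
    \<comment> \<open>Equal heights put the descent at its end, the vertex \<open>l\<close>; a row
      reaches an integer second coordinate only at its start.\<close>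
    have "real i + t / 4 = real l" "4 - u = 0"
      using eq unfolding row1(2) down(2) by simp_all
    then show ?thesis
      using row_hits_vertex[of i t l] row1(1) ij(2) by simp
  qed (use eq in \<open>simp_all add: row1(2)\<close>)
next
  case up1: up
  show ?thesis
    using kl(2,3)
  proof (cases rule: route_cases[where i = k and j = l])
    case up
    have x: "real j - shift i = real l - shift k" and "real i + 1/4 = real k + 1/4"
      and "t - 1 = u - 1"
      using eq unfolding up1(3) up(3) prod.inject by blast+
    then have "i = k" and t: "t = u"
      by simp_all
    from x have "j = l"
      unfolding \<open>i = k\<close> by simp
    with \<open>i = k\<close> t show ?thesis by blast
  next
    case down
    then show ?thesis
      using eq quarter_neq_nat[of i l] unfolding up1(3) by simp
  qed (use eq up1(1,2) in \<open>simp_all add: up1(3)\<close>)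
next
  case column1: column
  show ?thesis
    using kl(2,3)
  proof (cases rule: route_cases[where i = k and j = l])
    case column
    have "i = k \<and> j = l \<and> t - 2 = u - 2"
      using eq unfolding column1(3) column(3) prod.inject
      by (intro route_column_column[OF ij(1)]) blast+
    then show ?thesis by simp
  qed (use eq in \<open>simp_all add: column1(3)\<close>)
next
  case down1: down
  show ?thesis
    using kl(2,3)
  proof (cases rule: route_cases[where i = k and j = l])
    case row
    have "real k + u / 4 = real j" "4 - t = 0"
      using eq unfolding down1(2) row(2) by simp_all
    then show ?thesis
      using row_hits_vertex[of k u j] row(1) kl(2) by simp
  next
    case up
    then show ?thesis
      using eq quarter_neq_nat[of k j] unfolding down1(2) by simp
  next
    case column
    then show ?thesis
      using eq down1(1) unfolding down1(2) by simp
  next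
    case down
    have x: "real j - shift i * (4 - t) = real l - shift k * (4 - u)" and "real j = real l"
      and "4 - t = 4 - u"
      using eq unfolding down1(2) down(2) prod.inject by blast+
    then have "j = l" "t = u"
      by simp_all
    \<comment> \<open>Either \<open>t = 4\<close>, where the descents meet in the vertex
      \<open>j\<close>, or the factor cancels and \<open>shift\<close> determines the
      source.\<close>
    moreover from this have "shift i * (4 - t) = shift k * (4 - t)"
      using x by simp
    ultimately show ?thesis by (auto simp: shift_eq_iff)
  qed
qed

section \<open>The layout as an injective map on the realisation\<close>

fun layout :: "nat point \<Rightarrow> real \<times> real \<times> real" where
  "layout (Vertex v) = (real v, real v, 0)"
| "layout (Inner e t) = route (Min e) (Max e) (4 * t)"

text \<open>Parameters 0 and 1 give vertices, and a route begins and ends at their positions, so one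
  formula covers the whole closed edge.\<close>

lemma layout_edge_point: "layout (edge_point e t) = route (Min e) (Max e) (4 * t)"
  by (simp add: edge_point_def route_ends)

lemma complete_graph_edge:
  assumes "e \<in> edges (complete_graph M)"
  shows "Min e < Max e" "Max e < M" "e = {Min e, Max e}"
proof -
  from assms have e: "e \<subseteq> {..<M}" "card e = 2"
    by (auto simp: complete_graph_def)
  then obtain a b where ab: "e = {a, b}" "a \<noteq> b"
    by (auto simp: card_2_iff)
  with e show "Min e < Max e" "Max e < M" "e = {Min e, Max e}"
    by (auto simp: min_def max_def)
qed

lemma complete_graph_edge_ends:
  assumes "e \<in> edges (complete_graph M)"
  shows "Min e \<in> e" "Max e \<in> e"
  using complete_graph_edge(3)[OF assms] by blast+

lemma finite_complete_graph:
  "finite (verts (complete_graph M))" "finite (edges (complete_graph M))"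
  by (auto simp: complete_graph_def intro: finite_subset[of _ "Pow {..<M}"])

lemma points_complete_graph_cases:
  assumes "p \<in> points (complete_graph M)"
  obtains (vertex) v where "v < M" "p = Vertex v"
  | (edge) e t where "e \<in> edges (complete_graph M)" "0 \<le> t" "t \<le> 1" "p = edge_point e t"
  using assms by (auto simp: points_def closed_edge_def complete_graph_def)

lemma layout_in_box:
  assumes "p \<in> points (complete_graph M)"
  shows "layout p \<in> {0..real M} \<times> {0..real M} \<times> {0..1}"
  using assms
proof (cases rule: points_complete_graph_cases)
  case (edge e t)
  then show ?thesis
    using route_in_box[of "Min e" "Max e" M "4 * t"] complete_graph_edge[of e M]
    by (simp add: layout_edge_point)
qed auto

lemma edge_point_ends [simp]: "edge_point e 0 = Vertex (Min e)" "edge_point e 1 = Vertex (Max e)"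
  by (simp_all add: edge_point_def)

text \<open>The conclusion equates points, not edges and parameters, because a vertex is an end of
  many edges. Every alternative of \<open>route_inject\<close> yields the same point.\<close>

lemma layout_edge_points_inject:
  assumes e: "e \<in> edges (complete_graph M)" "0 \<le> t" "t \<le> 1"
    and f: "f \<in> edges (complete_graph M)" "0 \<le> u" "u \<le> 1"
    and eq: "layout (edge_point e t) = layout (edge_point f u)"
  shows "edge_point e t = edge_point f u"
proof -
  note E = complete_graph_edge[OF e(1)] and F = complete_graph_edge[OF f(1)]
  have *: "route (Min e) (Max e) (4 * t) = route (Min f) (Max f) (4 * u)"
    using eq by (simp add: layout_edge_point)
  consider "Min e = Min f" "Max e = Max f" "t = u" | "t = 0" "u = 0" "Min e = Min f"
    | "t = 1" "u = 1" "Max e = Max f" | "t = 1" "u = 0" "Max e = Min f"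
    | "t = 0" "u = 1" "Min e = Max f"
    using route_inject[OF E(1) _ _ F(1) _ _ *] e f by auto
  then show ?thesis
  proof cases
    case 1
    then show ?thesis using E(3) F(3) by metis
  qed auto
qed

text \<open>Separated points never coincide, so \<open>v\<close> is an endpoint of \<open>e\<close>,
  hence itself an edge point of \<open>e\<close> with parameter 0 or 1.\<close>

lemma layout_vertex_edge_point_inject:
  assumes e: "e \<in> edges (complete_graph M)" "0 \<le> t" "t \<le> 1"
    and eq: "layout (edge_point e t) = layout (Vertex v)"
  shows "edge_point e t = Vertex v"
proof -
  note E = complete_graph_edge[OF e(1)]
  have *: "route (Min e) (Max e) (4 * t) = (real v, real v, 0)"
    using eq by (simp add: layout_edge_point)
  have "\<not> separated (route (Min e) (Max e) (4 * t)) (real v, real v, 0)"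
    unfolding * by (simp add: separated_def)
  then consider "v = Min e" | "v = Max e"
    using separated_route_vertex[OF E(1)] e by fastforce
  then show ?thesis
  proof cases
    case 1
    then show ?thesis using layout_edge_points_inject[OF e e(1), of 0] eq by simp
  next
    case 2
    then show ?thesis using layout_edge_points_inject[OF e e(1), of 1] eq by simp
  qed
qed

lemma inj_on_layout: "inj_on layout (points (complete_graph M))"
proof (rule inj_onI)
  fix p q assume p: "p \<in> points (complete_graph M)" and q: "q \<in> points (complete_graph M)"
    and eq: "layout p = layout q"
  from p show "p = q"
  proof (cases rule: points_complete_graph_cases)
    case pv: (vertex v)
    from q show ?thesis
    proof (cases rule: points_complete_graph_cases)
      case (vertex w)
      then show ?thesis using pv eq by simp
    next
      case (edge e t)
      then show ?thesis
        using pv eq layout_vertex_edge_point_inject[of e M t v] by simp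
    qed
  next
    case pe: (edge e t)
    from q show ?thesis
    proof (cases rule: points_complete_graph_cases)
      case (vertex w)
      then show ?thesis
        using pe eq layout_vertex_edge_point_inject[of e M t w] by simp
    next
      case (edge f u)
      then show ?thesis
        using pe eq layout_edge_points_inject[of e M t f u] by simp
    qed
  qed
qed

section \<open>Embeddings of the realisation\<close>

text \<open>The universal property of the quotient topology: openness of a preimage is tested on the
  unit interval of each edge.\<close>

lemma continuous_map_realisation:
  assumes range: "g ` points G \<subseteq> topspace Y"
    and cont: "\<And>e. e \<in> edges G \<Longrightarrow> continuous_map (top_of_set {0..1}) Y (g \<circ> edge_point e)"
  shows "continuous_map (realisation G) Y g"
  unfolding continuous_map_def
proof (intro conjI allI impI)
  show "g \<in> topspace (realisation G) \<rightarrow> topspace Y"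
    using range by (auto simp: topspace_realisation)
  fix U assume U: "openin Y U"
  show "openin (realisation G) {p \<in> topspace (realisation G). g p \<in> U}"
    unfolding openin_realisation topspace_realisation
  proof (intro conjI ballI)
    fix e assume e: "e \<in> edges G"
    have "edge_point e t \<in> points G" if "t \<in> {0..1}" for t
      using e that unfolding points_def closed_edge_def by blast
    then have "{t \<in> {0..1}. edge_point e t \<in> {p \<in> points G. g p \<in> U}} =
        {t \<in> topspace (top_of_set {0..1}). (g \<circ> edge_point e) t \<in> U}"
      by auto
    then show "openin (top_of_set {0..1}) {t \<in> {0..1}. edge_point e t \<in> {p \<in> points G. g p \<in> U}}"
      using cont[OF e] U unfolding continuous_map_def by simp
  qed auto
qed

lemma continuous_map_edge_point:
  assumes "e \<in> edges G"
  shows "continuous_map (top_of_set {0..1}) (realisation G) (edge_point e)"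
  using assms unfolding continuous_map_def topspace_realisation
  by (auto simp: points_def closed_edge_def openin_realisation)

lemma compact_space_realisation:
  assumes "finite (verts G)" "finite (edges G)"
  shows "compact_space (realisation G)"
proof -
  have "compactin (realisation G) (closed_edge e)" if "e \<in> edges G" for e
    unfolding closed_edge_def
    by (rule image_compactin[OF _ continuous_map_edge_point[OF that]])
      (simp add: compactin_subtopology)
  moreover have "compactin (realisation G) (Vertex ` verts G)"
    using assms(1) by (intro finite_imp_compactin) (auto simp: topspace_realisation points_def)
  ultimately have "compactin (realisation G) (\<Union> (insert (Vertex ` verts G) (closed_edge ` edges G)))"
    using assms(2) by (intro compactin_Union) auto
  then show ?thesis
    by (simp add: compact_space_def topspace_realisation points_def)
qed

text \<open>Reduces both halves of the theorem to three properties of a map \<open>F\<close> on an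
  infinite slab, so that one \<open>F\<close> serves every \<open>M\<close>.\<close>

lemma thick_embedding_layout:
  fixes F :: "real \<times> real \<times> real \<Rightarrow> 'z::metric_space"
  assumes cont: "continuous_on (UNIV \<times> UNIV \<times> {0..1}) F"
    and inj: "inj_on F (UNIV \<times> UNIV \<times> {0..1})"
    and sep: "\<And>p q. p \<in> UNIV \<times> UNIV \<times> {0..1} \<Longrightarrow> q \<in> UNIV \<times> UNIV \<times> {0..1} \<Longrightarrow>
      separated p q \<Longrightarrow> 1 \<le> dist (F p) (F q)"
  shows "thick_embedding 1 (complete_graph M) (F \<circ> layout)"
proof -
  let ?G = "complete_graph M"
  have box: "layout p \<in> UNIV \<times> UNIV \<times> {0..1}" if "p \<in> points ?G" for p
    using layout_in_box[OF that] by auto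
  have vertex: "Vertex v \<in> points ?G" if "v \<in> verts ?G" for v
    using that by (simp add: points_def)
  have edge: "closed_edge e \<subseteq> points ?G" if "e \<in> edges ?G" for e
    using that by (auto simp: points_def)
  \<comment> \<open>\<open>setdist\<close> is 0 if one of the sets is empty, so lower bounds for it
    require nonempty images.\<close>
  have ne: "closed_edge e \<noteq> {}" for e :: "nat set"
    by (simp add: closed_edge_def)
  have "continuous_map (realisation ?G) euclidean (F \<circ> layout)"
  proof (rule continuous_map_realisation)
    fix e assume e: "e \<in> edges ?G"
    have "continuous_on {0..1} (\<lambda>t. F (layout (edge_point e t)))"
    proof (rule continuous_on_compose2[OF cont])
      show "continuous_on {0..1} (\<lambda>t. layout (edge_point e t))"
        unfolding layout_edge_point
        by (rule continuous_on_compose2[OF continuous_on_route[of UNIV]]) (auto intro!: continuous_intros)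
      show "(\<lambda>t. layout (edge_point e t)) ` {0..1} \<subseteq> UNIV \<times> UNIV \<times> {0..1}"
        using box edge[OF e] by (force simp: closed_edge_def)
    qed
    then show "continuous_map (top_of_set {0..1}) euclidean ((F \<circ> layout) \<circ> edge_point e)"
      by (simp add: o_def)
  qed auto
  moreover have "inj_on (F \<circ> layout) (points ?G)"
    using box by (intro comp_inj_on[OF inj_on_layout] inj_on_subset[OF inj]) blast
  \<comment> \<open>A continuous map from a compact space to a Hausdorff space is closed, and an
    injective continuous closed map is an embedding.\<close>
  ultimately have "embedding_map (realisation ?G) euclidean (F \<circ> layout)"
    by (intro injective_closed_imp_embedding_map continuous_imp_closed_map
        compact_space_realisation finite_complete_graph)
      (auto simp: topspace_realisation)
  moreover have "1 \<le> dist ((F \<circ> layout) (Vertex v)) ((F \<circ> layout) (Vertex w))"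
    if "v \<in> verts ?G" "w \<in> verts ?G" "v \<noteq> w" for v w
    using that sep[OF box[OF vertex] box[OF vertex]] separated_vertices[of v w 0 0] by simp
  moreover have "1 \<le> setdist ((F \<circ> layout) ` closed_edge e) {(F \<circ> layout) (Vertex v)}"
    if e: "e \<in> edges ?G" and v: "v \<in> verts ?G" "v \<notin> e" for e v
  proof (rule le_setdistI)
    fix x y assume "x \<in> (F \<circ> layout) ` closed_edge e" "y \<in> {(F \<circ> layout) (Vertex v)}"
    then obtain t where t: "0 \<le> t" "t \<le> 1" "x = F (layout (edge_point e t))"
      and y: "y = F (layout (Vertex v))"
      by (auto simp: closed_edge_def)
    have "separated (layout (edge_point e t)) (layout (Vertex v))"
      unfolding layout_edge_point layout.simps
      using complete_graph_edge(1)[OF e] complete_graph_edge_ends[OF e] v t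
      by (intro separated_route_vertex) auto
    then show "1 \<le> dist x y"
      unfolding t y using edge[OF e] t v
      by (intro sep box vertex) (auto simp: closed_edge_def)
  qed (use ne in auto)
  moreover have "1 \<le> setdist ((F \<circ> layout) ` closed_edge e) ((F \<circ> layout) ` closed_edge f)"
    if e: "e \<in> edges ?G" and f: "f \<in> edges ?G" and ef: "e \<inter> f = {}" for e f
  proof (rule le_setdistI)
    fix x y assume "x \<in> (F \<circ> layout) ` closed_edge e" "y \<in> (F \<circ> layout) ` closed_edge f"
    then obtain t u where t: "0 \<le> t" "t \<le> 1" "x = F (layout (edge_point e t))"
      and u: "0 \<le> u" "u \<le> 1" "y = F (layout (edge_point f u))"
      by (auto simp: closed_edge_def)
    have "separated (layout (edge_point e t)) (layout (edge_point f u))"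
      unfolding layout_edge_point
      using complete_graph_edge(1)[OF e] complete_graph_edge_ends[OF e]
        complete_graph_edge(1)[OF f] complete_graph_edge_ends[OF f] ef t u
      by (intro separated_routes) auto
    then show "1 \<le> dist x y"
      unfolding t u using edge[OF e] edge[OF f] t u
      by (intro sep box) (auto simp: closed_edge_def)
  qed (use ne in auto)
  ultimately show ?thesis
    unfolding thick_embedding_def by blast
qed

section \<open>Distance and volume in the half-space model\<close>

lemma cosh_one_le: "cosh (1::real) \<le> 5/3"
proof -
  have e: "1 \<le> exp (1::real)" "exp (1::real) \<le> 3"
    using exp_le exp_ge_add_one_self[of "1::real"] by linarith+
  \<comment> \<open>Divided by \<open>3 * exp 1\<close>, this product says that e + 1/e is at most 3
    + 1/3.\<close>
  then have "0 \<le> (3 - exp (1::real)) * (3 * exp 1 - 1)"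
    by (intro mult_nonneg_nonneg; linarith)
  then have "3 * (exp (1::real) * exp 1) + 3 \<le> 10 * exp 1"
    by (simp add: algebra_simps)
  then have "exp (1::real) + 1 / exp 1 \<le> 10/3"
    using e by (simp add: field_simps)
  then show ?thesis
    by (simp add: cosh_def exp_minus inverse_eq_divide)
qed

text \<open>Apply \<open>cosh\<close> to the hypothesis and use \<open>cosh 1 <= 5/3\<close>; the
  factor 4/3 is 2 * (5/3 - 1).\<close>

lemma dist_less_one_coords:
  fixes p q :: "'a::euclidean_space hyperbolic"
  assumes "dist p q < 1"
  shows "(dist (coords p) (coords q))\<^sup>2 < 4/3 * (height p * height q)"
proof -
  have "cosh (dist p q) < cosh 1"
    using assms by (intro cosh_real_strict_mono) auto
  then have "1 + (dist (coords p) (coords q))\<^sup>2 / (2 * height p * height q) < 5/3"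
    using cosh_one_le by (simp add: cosh_dist_hyperbolic)
  then have "(dist (coords p) (coords q))\<^sup>2 / (2 * height p * height q) < 2/3"
    by simp
  then have "(dist (coords p) (coords q))\<^sup>2 < 2/3 * (2 * height p * height q)"
    using height_pos[of p] height_pos[of q] by (subst (asm) pos_divide_less_eq) auto
  then show ?thesis by simp
qed

lemma dist_height_le: "\<bar>height p - height q\<bar> \<le> dist (coords p) (coords q)"
  using dist_snd_le[of "coords p" "coords q"] by (simp add: height_def dist_real_def)

text \<open>At distance below 1 the squared Euclidean distance would be less than 4/3 * 16, which is
  less than 25.\<close>

lemma one_le_dist_hyperbolic:
  assumes "height p \<le> 4" "height q \<le> 4" "5 \<le> dist (coords p) (coords q)"
  shows "1 \<le> dist p q"
proof (rule ccontr)
  assume "\<not> 1 \<le> dist p q"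
  then have "(dist (coords p) (coords q))\<^sup>2 < 4/3 * (height p * height q)"
    by (intro dist_less_one_coords) simp
  moreover have "height p * height q \<le> 4 * 4"
    using assms by (intro mult_mono) (auto simp: less_imp_le)
  moreover have "5\<^sup>2 \<le> (dist (coords p) (coords q))\<^sup>2"
    using assms(3) by (intro power_mono) auto
  ultimately show False by simp
qed

text \<open>The heights 1 and 4 are far enough apart because 9 exceeds 4/3 * 4.\<close>

lemma one_le_dist_hyperbolic_vertical:
  assumes "height p = 1" "height q = 4"
  shows "1 \<le> dist p q"
proof (rule ccontr)
  assume "\<not> 1 \<le> dist p q"
  then have "(dist (coords p) (coords q))\<^sup>2 < 4/3 * (height p * height q)"
    by (intro dist_less_one_coords) simp
  moreover have "3\<^sup>2 \<le> (dist (coords p) (coords q))\<^sup>2"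
    using dist_height_le[of p q] assms by (intro power_mono) auto
  ultimately show False using assms by simp
qed

lemma dist_less_one_bounds:
  fixes p q :: "'a::euclidean_space hyperbolic"
  assumes "dist p q < 1" "1 \<le> height q" "height q \<le> 4"
  shows "1/4 \<le> height p" "height p \<le> 14" "dist (coords p) (coords q) \<le> 9"
proof -
  define D where "D = dist (coords p) (coords q)"
  have D: "D\<^sup>2 < 4/3 * (height p * height q)"
    unfolding D_def by (rule dist_less_one_coords[OF assms(1)])
  have "\<bar>height p - height q\<bar>\<^sup>2 \<le> D\<^sup>2"
    unfolding D_def using dist_height_le by (intro power_mono) auto
  \<comment> \<open>Dropping either square from this inequality bounds the ratio of the heights by
    10/3 in one direction. With \<open>height q\<close> between 1 and 4 this gives the bounds 1/4
    and 14, and then 4/3 * 14 * 4 < 81.\<close>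
  with D have *: "height p * height p + height q * height q < 10/3 * (height p * height q)"
    by (simp add: power2_eq_square algebra_simps)
  have "height p * height p < (10/3 * height q) * height p"
    using * mult_pos_pos[OF height_pos[of q] height_pos[of q]] mult.commute[of "height p" "height q"]
    unfolding mult.assoc by linarith
  then have up: "height p < 10/3 * height q"
    using height_pos mult_less_cancel_right_pos by blast
  have "height q * height q < (10/3 * height p) * height q"
    using * mult_pos_pos[OF height_pos[of p] height_pos[of p]] unfolding mult.assoc by linarith
  then have low: "height q < 10/3 * height p"
    using height_pos mult_less_cancel_right_pos by blast
  show "1/4 \<le> height p" "height p \<le> 14"
    using up low assms by linarith+
  then have "height p * height q \<le> 14 * 4"
    using assms by (intro mult_mono) (auto simp: less_imp_le)
  with D have "D\<^sup>2 \<le> 9\<^sup>2" by simp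
  then show "dist (coords p) (coords q) \<le> 9"
    unfolding D_def by (rule power2_le_imp_le) simp
qed

text \<open>Heights at least 1 only lower the quotient in the formula for \<open>cosh\<close> of the
  distance, and \<open>exp d <= 2 * cosh d\<close>. This is the source of the logarithmic
  diameter.\<close>

lemma dist_hyperbolic_le_ln:
  fixes p q :: "'a::euclidean_space hyperbolic"
  assumes "1 \<le> height p" "1 \<le> height q"
  shows "dist p q \<le> ln (2 + (dist (coords p) (coords q))\<^sup>2)"
proof -
  have "1 * 1 \<le> height p * height q"
    using assms by (intro mult_mono) auto
  then have "(dist (coords p) (coords q))\<^sup>2 / (2 * height p * height q) \<le> (dist (coords p) (coords q))\<^sup>2 / 2"
    by (intro divide_left_mono) auto
  then have "2 * cosh (dist p q) \<le> 2 + (dist (coords p) (coords q))\<^sup>2"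
    by (simp add: cosh_dist_hyperbolic)
  moreover have "exp (dist p q) \<le> 2 * cosh (dist p q)"
    by (simp add: cosh_def)
  ultimately have "exp (dist p q) \<le> 2 + (dist (coords p) (coords q))\<^sup>2"
    by linarith
  moreover have "0 < 2 + (dist (coords p) (coords q))\<^sup>2"
    by (intro add_pos_nonneg) auto
  ultimately show ?thesis
    by (simp add: ln_ge_iff)
qed

lemma dist_hyperbolic_le_ln_nat:
  fixes p q :: "'a::euclidean_space hyperbolic"
  assumes "1 \<le> height p" "1 \<le> height q"
    and "1 \<le> M" "(dist (coords p) (coords q))\<^sup>2 \<le> 250 * (real M)\<^sup>2"
  shows "dist p q \<le> 10 * ln (1 + real M)"
proof -
  have M: "1 \<le> real M" using assms(3) by simp
  have "1 \<le> (real M)\<^sup>2" using M by simp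
  \<comment> \<open>Since 2 + 250 is below 2 ^ 8 and both 2 and \<open>M\<close> are at most
    \<open>1 + M\<close>, a pure power of \<open>1 + M\<close> results and the logarithm has no
    additive constant.\<close>
  then have "2 + (dist (coords p) (coords q))\<^sup>2 \<le> 2 ^ 8 * (real M)\<^sup>2"
    using assms(4) by simp
  also have "\<dots> \<le> (1 + real M) ^ 8 * (1 + real M)\<^sup>2"
    using M by (intro mult_mono power_mono) auto
  also have "\<dots> = (1 + real M) ^ 10"
    by (simp flip: power_add)
  finally have "ln (2 + (dist (coords p) (coords q))\<^sup>2) \<le> ln ((1 + real M) ^ 10)"
    by (intro ln_mono) (auto intro: add_pos_nonneg)
  also have "\<dots> = 10 * ln (1 + real M)"
    by (simp add: ln_realpow)
  finally show ?thesis
    using dist_hyperbolic_le_ln[OF assms(1,2)] by linarith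
qed

text \<open>From height 1/4 upwards the density is at most a power of 4, and the height interval is
  shorter than 14; what remains is the Lebesgue measure of the base.\<close>

lemma emeasure_hyperbolic_volume_le:
  fixes A :: "'a::euclidean_space hyperbolic set"
  assumes A: "A \<in> sets borel" and S: "S \<in> sets borel" and sub: "coords ` A \<subseteq> S \<times> {1/4..14}"
  shows "emeasure hyperbolic_volume A \<le> ennreal (14 * 4 ^ (DIM('a) + 1)) * emeasure lborel S"
proof -
  let ?c = "ennreal (4 ^ (DIM('a) + 1))"
  have meas: "S \<times> {1/4..14::real} \<in> sets lborel"
    using S by (simp add: borel_Times)
  have "emeasure hyperbolic_volume A =
      (\<integral>\<^sup>+ z \<in> coords ` A. ennreal (1 / snd z ^ (DIM('a) + 1)) \<partial>lborel)"
    by (rule emeasure_hyperbolic_volume[OF A])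
  also have "\<dots> \<le> (\<integral>\<^sup>+ z. ?c * indicator (S \<times> {1/4..14::real}) z \<partial>lborel)"
  proof (intro nn_integral_mono)
    fix z :: "'a \<times> real"
    show "ennreal (1 / snd z ^ (DIM('a) + 1)) * indicator (coords ` A) z
        \<le> ?c * indicator (S \<times> {1/4..14::real}) z"
    proof (cases "z \<in> coords ` A")
      case True
      then have z: "z \<in> S \<times> {1/4..14}" using sub by blast
      then have "1 / snd z \<le> 4" "0 < snd z" by (auto simp: field_simps)
      then have "(1 / snd z) ^ (DIM('a) + 1) \<le> 4 ^ (DIM('a) + 1)"
        by (intro power_mono) auto
      then show ?thesis using z True by (simp add: power_divide ennreal_leI del: power_Suc)
    qed simp
  qed
  also have "\<dots> = ?c * emeasure lborel (S \<times> {1/4..14::real})"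
    using meas by (rule nn_integral_cmult_indicator)
  also have "emeasure lborel (S \<times> {1/4..14::real}) = emeasure lborel S * emeasure lborel {1/4..14::real}"
    unfolding lborel_prod[symmetric] using S by (intro lborel.emeasure_pair_measure_Times) auto
  also have "emeasure lborel {1/4..14::real} = ennreal (14 - 1/4)"
    by (rule emeasure_lborel_Icc) simp
  also have "\<dots> \<le> ennreal 14"
    by (rule ennreal_leI) simp
  finally have "emeasure hyperbolic_volume A \<le> ?c * (emeasure lborel S * ennreal 14)"
    by (meson mult_left_mono order_trans zero_le)
  also have "\<dots> = ennreal (14 * 4 ^ (DIM('a) + 1)) * emeasure lborel S"
    by (simp add: ennreal_mult mult_ac del: power_Suc)
  finally show ?thesis .
qed

lemma open_neighbourhood: "open (neighbourhood r A)"
  by (auto simp: neighbourhood_def)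

lemma height_of_coords: "0 < h \<Longrightarrow> height (of_coords (x, h)) = h"
  by (simp add: height_def coords_of_coords)

lemma of_coords_inject_pos: "0 < h \<Longrightarrow> 0 < h' \<Longrightarrow> of_coords (x, h) = of_coords (y, h') \<longleftrightarrow> x = y \<and> h = h'"
  using of_coords_inject[of "(x, h)" "(y, h')"] by simp

text \<open>The hypothesis \<open>0 <= d\<close> covers the empty graph, whose image has diameter 0
  by convention.\<close>

lemma image_diameter_leI:
  assumes "0 \<le> d" "\<And>p q. p \<in> points G \<Longrightarrow> q \<in> points G \<Longrightarrow> dist (g p) (g q) \<le> d"
  shows "image_diameter G g \<le> d"
  unfolding image_diameter_def diameter_def using assms by (auto intro!: cSUP_least)

lemma points_complete_graph_0: "points (complete_graph 0) = {}"
  by (auto simp: points_def complete_graph_def)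

section \<open>The box in hyperbolic 3-space\<close>

definition plane_point :: "real \<Rightarrow> real \<Rightarrow> real ^ 2" where
  "plane_point a b = (\<chi> i. if i = 1 then a else b)"

lemma plane_point_nth [simp]: "plane_point a b $ 1 = a" "plane_point a b $ 2 = b"
  by (simp_all add: plane_point_def)

lemma plane_point_eq_iff: "plane_point a b = plane_point c d \<longleftrightarrow> a = c \<and> b = d"
  by (auto simp: vec_eq_iff forall_2)

lemma continuous_on_plane_point [continuous_intros]:
  "continuous_on S f \<Longrightarrow> continuous_on S g \<Longrightarrow> continuous_on S (\<lambda>x. plane_point (f x) (g x))"
  unfolding plane_point_def
proof (rule continuous_on_vec_lambda)
  show "continuous_on S (\<lambda>x. if i = 1 then f x else g x)"
    if "continuous_on S f" "continuous_on S g" for i :: 2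
    using that by (cases "i = 1") simp_all
qed

lemma dist_plane_point: "(dist (plane_point a b) (plane_point c d))\<^sup>2 = (a - c)\<^sup>2 + (b - d)\<^sup>2"
  by (simp add: dist_vec_def L2_set_def sum_2 dist_real_def)

lemma emeasure_lborel_square:
  assumes "a \<le> b"
  shows "emeasure lborel (cbox (plane_point a a) (plane_point b b)) = ennreal ((b - a)\<^sup>2)"
proof -
  have "cbox (plane_point a a) (plane_point b b) \<noteq> {}"
    using assms by (simp add: interval_ne_empty_cart forall_2)
  then have "measure lborel (cbox (plane_point a a) (plane_point b b)) = (b - a)\<^sup>2"
    by (simp add: content_cbox_cart UNIV_2 power2_eq_square)
  then show ?thesis
    using emeasure_eq_ennreal_measure[of lborel "cbox (plane_point a a) (plane_point b b)"]
      emeasure_lborel_cbox_finite[of "plane_point a a" "plane_point b b"] by (simp add: less_top)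
qed

text \<open>The factor 10 turns a horizontal gap of 1/2 into Euclidean distance 5, and the two
  layers go to the horospheres of heights 1 and 4, as the lower bounds for the distance
  demand.\<close>

definition to_hyp3 :: "real \<times> real \<times> real \<Rightarrow> hyp3" where
  "to_hyp3 = (\<lambda>(x, y, z). of_coords (plane_point (10 * x) (10 * y), 1 + 3 * z))"

lemma coords_to_hyp3:
  "0 \<le> z \<Longrightarrow> coords (to_hyp3 (x, y, z)) = (plane_point (10 * x) (10 * y), 1 + 3 * z)"
  by (simp add: to_hyp3_def coords_of_coords)

lemma height_to_hyp3: "0 \<le> z \<Longrightarrow> height (to_hyp3 (x, y, z)) = 1 + 3 * z"
  by (simp add: to_hyp3_def height_of_coords)

lemma inj_on_to_hyp3: "inj_on to_hyp3 (UNIV \<times> UNIV \<times> {0..1})"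
  by (auto simp: inj_on_def to_hyp3_def of_coords_inject_pos plane_point_eq_iff)

lemma continuous_on_to_hyp3: "continuous_on (UNIV \<times> UNIV \<times> {0..1}) to_hyp3"
  unfolding to_hyp3_def case_prod_beta
  by (rule continuous_on_compose2[OF continuous_on_of_coords]) (auto intro!: continuous_intros)

lemma unit_interval_ends:
  fixes z z' :: real
  assumes "\<bar>z - z'\<bar> = 1" "z \<in> {0..1}" "z' \<in> {0..1}"
  shows "z = 0 \<and> z' = 1 \<or> z = 1 \<and> z' = 0"
  using assms by (auto simp: abs_if split: if_splits)

lemma one_le_dist_to_hyp3:
  assumes "p \<in> UNIV \<times> UNIV \<times> {0..1}" "q \<in> UNIV \<times> UNIV \<times> {0..1}" "separated p q"
  shows "1 \<le> dist (to_hyp3 p) (to_hyp3 q)"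
proof -
  obtain x y z where p: "p = (x, y, z)" by (cases p)
  obtain x' y' z' where q: "q = (x', y', z')" by (cases q)
  have z: "0 \<le> z" "z \<le> 1" "0 \<le> z'" "z' \<le> 1"
    using assms p q by auto
  have horizontal: ?thesis
    if "5 \<le> dist (plane_point (10 * x) (10 * y)) (plane_point (10 * x') (10 * y'))"
  proof (rule one_le_dist_hyperbolic)
    show "5 \<le> dist (coords (to_hyp3 p)) (coords (to_hyp3 q))"
      using that dist_fst_le[of "coords (to_hyp3 p)" "coords (to_hyp3 q)"]
      by (simp add: p q coords_to_hyp3 z)
  qed (simp_all add: p q height_to_hyp3 z)
  from assms(3) consider "1/2 \<le> \<bar>x - x'\<bar>" | "1/2 \<le> \<bar>y - y'\<bar>" | "\<bar>z - z'\<bar> = 1"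
    by (auto simp: separated_def p q)
  then show ?thesis
  proof cases
    case 1
    then have "5 \<le> dist (10 * x) (10 * x')"
      unfolding dist_real_def by linarith
    then show ?thesis
      using dist_vec_nth_le[of "plane_point (10 * x) (10 * y)" 1 "plane_point (10 * x') (10 * y')"]
      by (intro horizontal) simp
  next
    case 2
    then have "5 \<le> dist (10 * y) (10 * y')"
      unfolding dist_real_def by linarith
    then show ?thesis
      using dist_vec_nth_le[of "plane_point (10 * x) (10 * y)" 2 "plane_point (10 * x') (10 * y')"]
      by (intro horizontal) simp
  next
    case 3
    then show ?thesis
      using unit_interval_ends[of z z'] z
        one_le_dist_hyperbolic_vertical[of "to_hyp3 p" "to_hyp3 q"]
        one_le_dist_hyperbolic_vertical[of "to_hyp3 q" "to_hyp3 p"]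
      by (auto simp: p q height_to_hyp3 dist_commute)
  qed
qed

lemma scaled_square_diff_le:
  fixes a b :: real
  assumes "a \<in> {0..c}" "b \<in> {0..c}"
  shows "(k * a - k * b)\<^sup>2 \<le> k\<^sup>2 * c\<^sup>2"
proof -
  have "\<bar>a - b\<bar>\<^sup>2 \<le> c\<^sup>2"
    using assms by (intro power_mono) auto
  then have "k\<^sup>2 * (a - b)\<^sup>2 \<le> k\<^sup>2 * c\<^sup>2"
    by (intro mult_left_mono) auto
  then show ?thesis
    by (simp add: power_mult_distrib flip: right_diff_distrib)
qed

lemma dist_to_hyp3_le:
  assumes "1 \<le> M" and p: "p \<in> {0..real M} \<times> {0..real M} \<times> {0..1}"
    and q: "q \<in> {0..real M} \<times> {0..real M} \<times> {0..1}"
  shows "dist (to_hyp3 p) (to_hyp3 q) \<le> 10 * ln (1 + real M)"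
proof -
  obtain x y z where P: "p = (x, y, z)" by (cases p)
  obtain x' y' z' where Q: "q = (x', y', z')" by (cases q)
  have z: "0 \<le> z" "0 \<le> z'" using p q by (auto simp: P Q)
  show ?thesis
  proof (rule dist_hyperbolic_le_ln_nat)
    \<comment> \<open>The three coordinates contribute 100, 100 and 9, in total less than
      250.\<close>
    have "(10 * x - 10 * x')\<^sup>2 \<le> 100 * (real M)\<^sup>2"
      "(10 * y - 10 * y')\<^sup>2 \<le> 100 * (real M)\<^sup>2" "(3 * z - 3 * z')\<^sup>2 \<le> 9"
      using p q scaled_square_diff_le[of x M x' 10] scaled_square_diff_le[of y M y' 10]
        scaled_square_diff_le[of z 1 z' 3] by (simp_all add: P Q)
    moreover have "1 \<le> (real M)\<^sup>2" using assms(1) by simp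
    ultimately show "(dist (coords (to_hyp3 p)) (coords (to_hyp3 q)))\<^sup>2 \<le> 250 * (real M)\<^sup>2"
      using z by (simp add: P Q coords_to_hyp3 dist_Pair_Pair dist_plane_point dist_real_def
          power_mult_distrib)
  qed (use assms(1) z in \<open>simp_all add: P Q height_to_hyp3\<close>)
qed

lemma volume_to_hyp3:
  assumes "1 \<le> M"
  shows "image_volume hyperbolic_volume (complete_graph M) (to_hyp3 \<circ> layout)
    \<le> ennreal (1000000 * (real M)\<^sup>2)"
proof -
  let ?N = "neighbourhood 1 ((to_hyp3 \<circ> layout) ` points (complete_graph M))"
  \<comment> \<open>The margin 9 is the Euclidean radius from
    \<open>dist_less_one_bounds\<close>.\<close>
  let ?a = "- 9 :: real" and ?b = "10 * real M + 9"
  let ?S = "cbox (plane_point ?a ?a) (plane_point ?b ?b)"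
  have "coords ` ?N \<subseteq> ?S \<times> {1/4..14}"
  proof (rule image_subsetI)
    fix r assume "r \<in> ?N"
    then obtain g where g: "g \<in> points (complete_graph M)" and r: "dist r (to_hyp3 (layout g)) < 1"
      by (auto simp: neighbourhood_def dist_commute)
    obtain x y z where L: "layout g = (x, y, z)" by (cases "layout g")
    have box: "0 \<le> x" "x \<le> M" "0 \<le> y" "y \<le> M" "0 \<le> z" "z \<le> 1"
      using layout_in_box[OF g] by (auto simp: L)
    note b = dist_less_one_bounds[OF r]
    have h: "1/4 \<le> height r" "height r \<le> 14" "dist (coords r) (coords (to_hyp3 (layout g))) \<le> 9"
      using b box by (simp_all add: L height_to_hyp3)
    have "dist (fst (coords r)) (plane_point (10 * x) (10 * y)) \<le> 9"
      using h(3) dist_fst_le[of "coords r" "coords (to_hyp3 (layout g))"] box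
      by (simp add: L coords_to_hyp3)
    then have "dist (fst (coords r) $ 1) (10 * x) \<le> 9" "dist (fst (coords r) $ 2) (10 * y) \<le> 9"
      using dist_vec_nth_le[of "fst (coords r)" 1 "plane_point (10 * x) (10 * y)"]
        dist_vec_nth_le[of "fst (coords r)" 2 "plane_point (10 * x) (10 * y)"] by simp_all
    then have "fst (coords r) \<in> ?S"
      using box by (simp add: mem_box_cart forall_2 dist_real_def) linarith
    with h show "coords r \<in> ?S \<times> {1/4..14}"
      by (cases "coords r") (simp add: height_def)
  qed
  then have "emeasure hyperbolic_volume ?N \<le> ennreal (14 * 4 ^ (DIM(real ^ 2) + 1)) * emeasure lborel ?S"
    by (intro emeasure_hyperbolic_volume_le[OF borel_open[OF open_neighbourhood]]) auto
  also have "\<dots> = ennreal (896 * (10 * real M + 18)\<^sup>2)"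
    by (simp add: emeasure_lborel_square add.commute flip: ennreal_mult ennreal_numeral)
  also have "\<dots> \<le> ennreal (1000000 * (real M)\<^sup>2)"
  proof (rule ennreal_leI)
    \<comment> \<open>Because \<open>M\<close> is at least 1, the margin is absorbed into a multiple
      of \<open>M\<close>; 896 = 14 * 4 ^ 3, and 896 * 784 is below one million.\<close>
    have "(10 * real M + 18)\<^sup>2 \<le> (28 * real M)\<^sup>2"
      using assms by (intro power_mono) auto
    then have "(10 * real M + 18)\<^sup>2 \<le> 784 * (real M)\<^sup>2"
      by (simp add: power_mult_distrib)
    then show "896 * (10 * real M + 18)\<^sup>2 \<le> 1000000 * (real M)\<^sup>2"
      using zero_le_power2[of "real M"] by linarith
  qed
  finally show ?thesis
    by (simp add: image_volume_def)
qed

section \<open>The box in the product of the hyperbolic plane and a line\<close>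

definition to_hyp2_line :: "real \<times> real \<times> real \<Rightarrow> hyp2 \<times> real" where
  "to_hyp2_line = (\<lambda>(x, y, z). (of_coords (10 * x, 1 + 3 * z), 10 * y))"

lemma fst_to_hyp2_line:
  assumes "0 \<le> z"
  shows "coords (fst (to_hyp2_line (x, y, z))) = (10 * x, 1 + 3 * z)"
    "height (fst (to_hyp2_line (x, y, z))) = 1 + 3 * z"
  using assms by (simp_all add: to_hyp2_line_def coords_of_coords height_of_coords)

lemma snd_to_hyp2_line: "snd (to_hyp2_line (x, y, z)) = 10 * y"
  by (simp add: to_hyp2_line_def)

lemma inj_on_to_hyp2_line: "inj_on to_hyp2_line (UNIV \<times> UNIV \<times> {0..1})"
  by (auto simp: inj_on_def to_hyp2_line_def of_coords_inject_pos)

lemma continuous_on_to_hyp2_line: "continuous_on (UNIV \<times> UNIV \<times> {0..1}) to_hyp2_line"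
  unfolding to_hyp2_line_def case_prod_beta
  by (intro continuous_on_Pair continuous_on_compose2[OF continuous_on_of_coords])
    (auto intro!: continuous_intros)

text \<open>The projections of a product do not increase distance, so a gap in one factor suffices:
  \<open>y\<close> is read in the line, \<open>x\<close> and \<open>z\<close> in the hyperbolic
  plane.\<close>

lemma one_le_dist_to_hyp2_line:
  assumes "p \<in> UNIV \<times> UNIV \<times> {0..1}" "q \<in> UNIV \<times> UNIV \<times> {0..1}" "separated p q"
  shows "1 \<le> dist (to_hyp2_line p) (to_hyp2_line q)"
proof -
  obtain x y z where p: "p = (x, y, z)" by (cases p)
  obtain x' y' z' where q: "q = (x', y', z')" by (cases q)
  let ?u = "to_hyp2_line p" and ?v = "to_hyp2_line q"
  have z: "0 \<le> z" "z \<le> 1" "0 \<le> z'" "z' \<le> 1"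
    using assms p q by auto
  from assms(3) consider "1/2 \<le> \<bar>x - x'\<bar>" | "1/2 \<le> \<bar>y - y'\<bar>" | "\<bar>z - z'\<bar> = 1"
    by (auto simp: separated_def p q)
  then have "1 \<le> dist (fst ?u) (fst ?v) \<or> 1 \<le> dist (snd ?u) (snd ?v)"
  proof cases
    case 1
    then have "5 \<le> dist (10 * x) (10 * x')"
      unfolding dist_real_def by linarith
    then have "5 \<le> dist (coords (fst ?u)) (coords (fst ?v))"
      using dist_fst_le[of "coords (fst ?u)" "coords (fst ?v)"]
      by (simp add: p q fst_to_hyp2_line z)
    then have "1 \<le> dist (fst ?u) (fst ?v)"
      by (intro one_le_dist_hyperbolic) (simp_all add: p q fst_to_hyp2_line z)
    then show ?thesis ..
  next
    case 2
    then have "1 \<le> dist (10 * y) (10 * y')"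
      unfolding dist_real_def by linarith
    then show ?thesis
      by (simp add: p q snd_to_hyp2_line)
  next
    case 3
    then show ?thesis
      using unit_interval_ends[of z z'] z
        one_le_dist_hyperbolic_vertical[of "fst ?u" "fst ?v"]
        one_le_dist_hyperbolic_vertical[of "fst ?v" "fst ?u"]
      by (auto simp: p q fst_to_hyp2_line dist_commute)
  qed
  then show ?thesis
    using dist_fst_le[of ?u ?v] dist_snd_le[of ?u ?v] by linarith
qed

text \<open>The hyperbolic factor contributes a logarithm, bounded by
  \<open>ln (1 + M) <= M\<close>; the line factor is genuinely linear.\<close>

lemma dist_to_hyp2_line_le:
  assumes "1 \<le> M" and p: "p \<in> {0..real M} \<times> {0..real M} \<times> {0..1}"
    and q: "q \<in> {0..real M} \<times> {0..real M} \<times> {0..1}"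
  shows "dist (to_hyp2_line p) (to_hyp2_line q) \<le> 20 * real M"
proof -
  obtain x y z where P: "p = (x, y, z)" by (cases p)
  obtain x' y' z' where Q: "q = (x', y', z')" by (cases q)
  let ?u = "to_hyp2_line p" and ?v = "to_hyp2_line q"
  have z: "0 \<le> z" "0 \<le> z'" using p q by (auto simp: P Q)
  have "dist (fst ?u) (fst ?v) \<le> 10 * ln (1 + real M)"
  proof (rule dist_hyperbolic_le_ln_nat)
    have "(10 * x - 10 * x')\<^sup>2 \<le> 100 * (real M)\<^sup>2" "(3 * z - 3 * z')\<^sup>2 \<le> 9"
      using p q scaled_square_diff_le[of x M x' 10] scaled_square_diff_le[of z 1 z' 3]
      by (simp_all add: P Q)
    moreover have "1 \<le> (real M)\<^sup>2" using assms(1) by simp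
    ultimately show "(dist (coords (fst ?u)) (coords (fst ?v)))\<^sup>2 \<le> 250 * (real M)\<^sup>2"
      using z by (simp add: P Q fst_to_hyp2_line dist_Pair_Pair dist_real_def power_mult_distrib)
  qed (use assms(1) z in \<open>simp_all add: P Q fst_to_hyp2_line\<close>)
  also have "\<dots> \<le> 10 * real M"
    using ln_add_one_self_le_self[of "real M"] by simp
  finally have "dist (fst ?u) (fst ?v) \<le> 10 * real M" .
  moreover have "dist (snd ?u) (snd ?v) \<le> 10 * real M"
    using p q by (auto simp: P Q snd_to_hyp2_line dist_real_def)
  moreover have "dist ?u ?v \<le> dist (fst ?u) (fst ?v) + dist (snd ?u) (snd ?v)"
    unfolding dist_prod_def by (rule sqrt_sum_squares_le_sum) auto
  ultimately show ?thesis by linarith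
qed

lemma volume_to_hyp2_line:
  assumes "1 \<le> M"
  shows "image_volume (hyperbolic_volume \<Otimes>\<^sub>M lborel) (complete_graph M) (to_hyp2_line \<circ> layout)
    \<le> ennreal (1000000 * (real M)\<^sup>2)"
proof -
  let ?G = "points (complete_graph M)"
  let ?N = "neighbourhood 1 ((fst \<circ> to_hyp2_line \<circ> layout) ` ?G)"
  let ?S = "{- 9..10 * real M + 9}" and ?I = "{- 1..10 * real M + 1}"
  \<comment> \<open>The neighbourhood is enclosed in a product of neighbourhoods of the two
    projections, whose measure factorises.\<close>
  have sub: "neighbourhood 1 ((to_hyp2_line \<circ> layout) ` ?G) \<subseteq> ?N \<times> ?I"
  proof
    fix r assume "r \<in> neighbourhood 1 ((to_hyp2_line \<circ> layout) ` ?G)"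
    then obtain g where g: "g \<in> ?G" and r: "dist (to_hyp2_line (layout g)) r < 1"
      by (auto simp: neighbourhood_def)
    obtain x y z where L: "layout g = (x, y, z)" by (cases "layout g")
    have box: "0 \<le> y" "y \<le> M"
      using layout_in_box[OF g] by (auto simp: L)
    have "dist (fst (to_hyp2_line (layout g))) (fst r) < 1"
      using r dist_fst_le order_le_less_trans by blast
    then have "fst r \<in> ?N"
      using g by (auto simp: neighbourhood_def)
    moreover have "dist (snd (to_hyp2_line (layout g))) (snd r) < 1"
      using r dist_snd_le order_le_less_trans by blast
    then have "snd r \<in> ?I"
      using box by (simp add: L snd_to_hyp2_line dist_real_def) linarith
    ultimately show "r \<in> ?N \<times> ?I"
      by (simp add: mem_Times_iff)
  qed
  have "coords ` ?N \<subseteq> ?S \<times> {1/4..14}"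
  proof (rule image_subsetI)
    fix r assume "r \<in> ?N"
    then obtain g where g: "g \<in> ?G" and r: "dist r (fst (to_hyp2_line (layout g))) < 1"
      by (auto simp: neighbourhood_def dist_commute)
    obtain x y z where L: "layout g = (x, y, z)" by (cases "layout g")
    have box: "0 \<le> x" "x \<le> M" "0 \<le> z" "z \<le> 1"
      using layout_in_box[OF g] by (auto simp: L)
    note b = dist_less_one_bounds[OF r]
    have h: "1/4 \<le> height r" "height r \<le> 14"
      "dist (coords r) (coords (fst (to_hyp2_line (layout g)))) \<le> 9"
      using b box by (simp_all add: L fst_to_hyp2_line)
    have "dist (fst (coords r)) (10 * x) \<le> 9"
      using h(3) dist_fst_le[of "coords r" "coords (fst (to_hyp2_line (layout g)))"] box
      by (simp add: L fst_to_hyp2_line)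
    then have "fst (coords r) \<in> ?S"
      using box by (simp add: dist_real_def) linarith
    with h show "coords r \<in> ?S \<times> {1/4..14}"
      by (cases "coords r") (simp add: height_def)
  qed
  then have vol: "emeasure hyperbolic_volume ?N \<le> ennreal (14 * 4 ^ (DIM(real) + 1)) * emeasure lborel ?S"
    by (intro emeasure_hyperbolic_volume_le[OF borel_open[OF open_neighbourhood]]) auto
  have N: "?N \<in> sets hyperbolic_volume"
    unfolding sets_hyperbolic_volume by (rule borel_open[OF open_neighbourhood])
  have "image_volume (hyperbolic_volume \<Otimes>\<^sub>M lborel) (complete_graph M) (to_hyp2_line \<circ> layout)
      \<le> emeasure (hyperbolic_volume \<Otimes>\<^sub>M lborel) (?N \<times> ?I)"
    unfolding image_volume_def using sub N by (intro emeasure_mono) auto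
  also have "\<dots> = emeasure hyperbolic_volume ?N * emeasure lborel ?I"
    using N by (intro lborel.emeasure_pair_measure_Times) auto
  also have "\<dots> \<le> (ennreal (14 * 4 ^ (DIM(real) + 1)) * emeasure lborel ?S) * emeasure lborel ?I"
    using vol by (rule mult_right_mono) simp
  also have "\<dots> = ennreal (224 * ((10 * real M + 18) * (10 * real M + 2)))"
    by (simp add: mult.assoc add.commute del: ennreal_plus flip: ennreal_mult ennreal_numeral)
  also have "\<dots> \<le> ennreal (1000000 * (real M)\<^sup>2)"
  proof (rule ennreal_leI)
    \<comment> \<open>The factors are the lengths of the widened base and of the widened line
      segment; 224 = 14 * 4 ^ 2.\<close>
    have "(10 * real M + 18) * (10 * real M + 2) \<le> (28 * real M) * (12 * real M)"
      using assms by (intro mult_mono) auto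
    then have "(10 * real M + 18) * (10 * real M + 2) \<le> 336 * (real M)\<^sup>2"
      by (simp add: power2_eq_square)
    then show "224 * ((10 * real M + 18) * (10 * real M + 2)) \<le> 1000000 * (real M)\<^sup>2"
      using zero_le_power2[of "real M"] by linarith
  qed
  finally show ?thesis .
qed

theorem theorem1p8:
  shows "\<exists>C::real. \<forall>M::nat.
    (\<exists>g :: nat point \<Rightarrow> hyp3.
       thick_embedding 1 (complete_graph M) g \<and>
       image_diameter (complete_graph M) g \<le> C * ln (1 + real M) \<and>
       image_volume hyperbolic_volume (complete_graph M) g \<le> ennreal (C * (real M)\<^sup>2)) \<and>
    (\<exists>g :: nat point \<Rightarrow> hyp2 \<times> real.
       thick_embedding 1 (complete_graph M) g \<and>
       image_diameter (complete_graph M) g \<le> C * real M \<and>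
       image_volume (hyperbolic_volume \<Otimes>\<^sub>M lborel) (complete_graph M) g \<le> ennreal (C * (real M)\<^sup>2))"
\<comment> \<open>The constant is dictated by the volume in hyperbolic 3-space; the other bounds
  hold with smaller factors.\<close>
proof (intro exI[of _ 1000000] allI conjI)
  fix M :: nat
  let ?G = "complete_graph M"
  \<comment> \<open>The distance bounds assume \<open>1 <= M\<close>, which the existence of a point
    guarantees; thus the diameter needs no case split.\<close>
  have pos: "1 \<le> M" if "p \<in> points ?G" for p
    using that points_complete_graph_0 by (cases M) auto
  show "\<exists>g :: nat point \<Rightarrow> hyp3. thick_embedding 1 ?G g \<and>
      image_diameter ?G g \<le> 1000000 * ln (1 + real M) \<and>
      image_volume hyperbolic_volume ?G g \<le> ennreal (1000000 * (real M)\<^sup>2)"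
  proof (intro exI[of _ "to_hyp3 \<circ> layout"] conjI)
    show "thick_embedding 1 ?G (to_hyp3 \<circ> layout)"
      by (intro thick_embedding_layout continuous_on_to_hyp3 inj_on_to_hyp3 one_le_dist_to_hyp3)
    show "image_diameter ?G (to_hyp3 \<circ> layout) \<le> 1000000 * ln (1 + real M)"
    proof (rule image_diameter_leI)
      fix p q assume "p \<in> points ?G" "q \<in> points ?G"
      then have "dist (to_hyp3 (layout p)) (to_hyp3 (layout q)) \<le> 10 * ln (1 + real M)"
        by (intro dist_to_hyp3_le pos layout_in_box)
      also have "\<dots> \<le> 1000000 * ln (1 + real M)"
        by (intro mult_right_mono) auto
      finally show "dist ((to_hyp3 \<circ> layout) p) ((to_hyp3 \<circ> layout) q) \<le> 1000000 * ln (1 + real M)"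
        by simp
    qed simp
    show "image_volume hyperbolic_volume ?G (to_hyp3 \<circ> layout) \<le> ennreal (1000000 * (real M)\<^sup>2)"
    \<comment> \<open>The widened box has positive volume even for \<open>M = 0\<close>, so the
      empty graph is treated directly: its neighbourhood is empty.\<close>
    proof (cases "M = 0")
      case True
      then show ?thesis
        by (simp add: image_volume_def neighbourhood_def points_complete_graph_0)
    qed (simp add: volume_to_hyp3)
  qed
  show "\<exists>g :: nat point \<Rightarrow> hyp2 \<times> real. thick_embedding 1 ?G g \<and>
      image_diameter ?G g \<le> 1000000 * real M \<and>
      image_volume (hyperbolic_volume \<Otimes>\<^sub>M lborel) ?G g \<le> ennreal (1000000 * (real M)\<^sup>2)"
  proof (intro exI[of _ "to_hyp2_line \<circ> layout"] conjI)
    show "thick_embedding 1 ?G (to_hyp2_line \<circ> layout)"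
      by (intro thick_embedding_layout continuous_on_to_hyp2_line inj_on_to_hyp2_line
          one_le_dist_to_hyp2_line)
    show "image_diameter ?G (to_hyp2_line \<circ> layout) \<le> 1000000 * real M"
    proof (rule image_diameter_leI)
      fix p q assume "p \<in> points ?G" "q \<in> points ?G"
      then have "dist (to_hyp2_line (layout p)) (to_hyp2_line (layout q)) \<le> 20 * real M"
        by (intro dist_to_hyp2_line_le pos layout_in_box)
      then show "dist ((to_hyp2_line \<circ> layout) p) ((to_hyp2_line \<circ> layout) q) \<le> 1000000 * real M"
        by simp
    qed simp
    show "image_volume (hyperbolic_volume \<Otimes>\<^sub>M lborel) ?G (to_hyp2_line \<circ> layout)
        \<le> ennreal (1000000 * (real M)\<^sup>2)"
    proof (cases "M = 0")
      case True
      then show ?thesis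
        by (simp add: image_volume_def neighbourhood_def points_complete_graph_0)
    qed (simp add: volume_to_hyp2_line)
  qed
qed

end
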